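(* For every $n\geq 1$, $|\mathcal{D}_n^1(321)|=|\mathcal{D}_n^1(132)|$. Moreover, $$1+\sum_{n\geq 1}|\mathcal{D}_n^1(321)|x^n=\frac{1-3x+3x^2+2x^3+(x^2+x-1)\sqrt{1-4x}}{2x^2(1-x)(2+x)}.$$
   Context: $\mathfrak{S}_n$ is the set of permutations of $[n]=\{1,\dots,n\}$, with $\mathrm{FIX}(\pi)=\{i:\pi(i)=i\}$. For $\pi\in\mathfrak{S}_n$, consider the word obtained from $\pi(1)\cdots\pi(n)$ by replacing $\pi(i)$ with $-1$ for every $i\in\mathrm{FIX}(\pi)$, and then replacing every occurrence of the $i$-th smallest positive letter by $i$ for all $i$ (the letters $-1$ unchanged). $\mathcal{D}_n^1$ is the set of all such words for $\pi\in\mathfrak{S}_n$ (the derangement forms of $1$-arrangements of $[n]$). For an integer word $w$, $\mathrm{red}(w)$ is obtained by replacing every occurrence of the $i$-th smallest letter of $w$ by $i$, for all $i$. A word $w=w_1\cdots w_n$ avoids a pattern $\sigma\in\mathfrak{S}_j$ if there are no indices $i_1<\cdots<i_j$ with $\mathrm{red}(w_{i_1}\cdots w_{i_j})=\sigma$. $\mathcal{D}_n^1(\sigma)$ is the set of words in $\mathcal{D}_n^1$ avoiding $\sigma$. *)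

theory Defs
  imports "HOL-Combinatorics.Multiset_Permutations" "HOL-Computational_Algebra.Formal_Power_Series"
begin

(* A permutation pi of [n] is represented by its one-line notation: a list p with
   p ! (i-1) = pi(i). *)

definition std_pos :: "int list \<Rightarrow> int list" where
  "std_pos v = map (\<lambda>x. if x = -1 then -1 else int (card {y \<in> set v. 0 < y \<and> y \<le> x})) v"

(* derangement form of the 1-arrangement given by permutation p (one-line notation) *)
definition der_form :: "nat list \<Rightarrow> int list" where
  "der_form p = std_pos (map (\<lambda>i. if p ! i = i + 1 then -1 else int (p ! i)) [0..<length p])"

definition D1 :: "nat \<Rightarrow> int list set" where
  "D1 n = der_form ` permutations_of_set {1..n}"

definition red :: "int list \<Rightarrow> nat list" where
  "red w = map (\<lambda>x. card {y \<in> set w. y \<le> x}) w"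

definition avoids :: "int list \<Rightarrow> nat list \<Rightarrow> bool" where
  "avoids w \<sigma> \<longleftrightarrow> \<not> (\<exists>u \<in> set (subseqs w). red u = \<sigma>)"

definition D1_av :: "nat \<Rightarrow> nat list \<Rightarrow> int list set" where
  "D1_av n \<sigma> = {w \<in> D1 n. avoids w \<sigma>}"

definition sqrt_1m4x :: "real fps" where
  "sqrt_1m4x = fps_radical (\<lambda>k x. root k x) 2 (1 - 4 * fps_X)"

end

theory Submission
  imports Defs "HOL-Library.Sublist"
begin

text \<open>
  A word of the set is a shuffle of a derangement \<open>d\<close> of \<open>[m]\<close> with \<open>n - m\<close> letters \<open>-1\<close>.
  For 132 it avoids the pattern iff \<open>d\<close> does and the letters after the first \<open>-1\<close> increase, so \<open>d\<close>
  contributes \<open>(s + n - m) choose (n - m)\<close> words, where \<open>s\<close> is the length of the longest increasing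
  suffix of \<open>d\<close>; reverse-complementing gives the same count for 321. Weighting a permutation by
  \<open>q ^ s\<close>, the task is to compare the generating functions \<open>F(q)\<close> of pattern-avoiding derangements
  at \<open>q = 1 / (1 - x)\<close>.

  Inserting the minimum (132) or the maximum (321) gives for both patterns the Catalan
  generating tree \<open>s \<mapsto> 1, \<dots>, s + 1\<close>, hence the same generating function \<open>T(q)\<close> of all avoiding permutations,
  with \<open>(q - 1) (T(q) - 1) = x q (q T(q) - T(1))\<close>. The kernel method (\<open>q\<close> the Catalan series) gives
  \<open>T(1) = C\<close>, and \<open>q = 1 / (1 - x)\<close> gives \<open>T(q) = (1 - x) C\<^sup>2\<close>.

  A 321-avoiding permutation is a direct sum at its largest fixed point. For 132, the entries to the left of the
  smallest fixed point that are below it form a block, a derangement of an interval of values at the same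
  positions; deleting the block and the fixed point leaves an arbitrary 132-avoiding permutation,
  because each of these has exactly one place where a block can be inserted. Both
  decompositions lead to \<open>F (1 + x C) = (1 - 2 x) C\<^sup>2 + x C\<close> at \<open>q = 1 / (1 - x)\<close>.
\<close>

section \<open>Pattern avoidance and increasing suffixes\<close>

text \<open>\<open>av (>)\<close> is avoidance of 321 and \<open>av (<)\<close> avoidance of 132; with \<open>\<le>\<close> inside \<^const>\<open>sorted\<close> this is also
  right for words with repeated letters.\<close>

fun av :: "('a::linorder \<Rightarrow> 'a \<Rightarrow> bool) \<Rightarrow> 'a list \<Rightarrow> bool" where
  "av r [] \<longleftrightarrow> True"
| "av r (x # xs) \<longleftrightarrow> sorted (filter (r x) xs) \<and> av r xs"

fun inc_suffix :: "'a::linorder list \<Rightarrow> nat" where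
  "inc_suffix [] = 0"
| "inc_suffix (x # xs) = (if sorted (x # xs) then Suc (length xs) else inc_suffix xs)"

lemma sorted_iff_subseq: "sorted l \<longleftrightarrow> (\<forall>b c. subseq [b, c] l \<longrightarrow> b \<le> c)"
proof (induction l)
  case (Cons x l)
  have "subseq [b, c] (x # l) \<longleftrightarrow> subseq [b, c] l \<or> b = x \<and> c \<in> set l" for b c
    by (metis subseq_Cons' subseq_Cons2_iff subseq_Cons2_neq subseq_singleton_left list_emb_Cons)
  with Cons show ?case by auto
qed auto

lemma subseq_filter_iff: "subseq xs (filter P ys) \<longleftrightarrow> subseq xs ys \<and> (\<forall>x\<in>set xs. P x)"
proof (intro iffI conjI)
  assume "subseq xs (filter P ys)"
  then show "subseq xs ys" "\<forall>x\<in>set xs. P x"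
    using list_emb_set[of "(=)" xs "filter P ys"]
    by (meson subseq_filter_left subseq_order.trans, auto)
next
  assume "subseq xs ys \<and> (\<forall>x\<in>set xs. P x)"
  then show "subseq xs (filter P ys)"
    using subseq_filter[of xs ys P] by (simp add: filter_id_conv)
qed

text \<open>The forbidden triple is \<open>r a b\<close>, \<open>r a c\<close>,
  \<open>c < b\<close>. For \<open>(>)\<close> this amounts to \<open>c < b < a\<close>, for
  \<open>(<)\<close> to \<open>a < c < b\<close>. In this form avoidance visibly passes to
  subsequences.\<close>

lemma av_iff_subseq:
  "av r l \<longleftrightarrow> (\<forall>a b c. subseq [a, b, c] l \<longrightarrow> r a b \<longrightarrow> r a c \<longrightarrow> b \<le> c)"
proof (induction l)
  case (Cons x l)
  have "subseq [a, b, c] (x # l) \<longleftrightarrow> subseq [a, b, c] l \<or> a = x \<and> subseq [b, c] l" for a b c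
    by (metis subseq_Cons' subseq_Cons2_iff subseq_Cons2_neq list_emb_Cons)
  with Cons show ?case by (auto simp: sorted_iff_subseq subseq_filter_iff)
qed auto

section \<open>Patterns of length three as inequalities between letters\<close>

lemma red_triple:
  "red u = [i, j, k] \<longleftrightarrow> (\<exists>a b c. u = [a, b, c] \<and> card {y \<in> {a, b, c}. y \<le> a} = i \<and>
     card {y \<in> {a, b, c}. y \<le> b} = j \<and> card {y \<in> {a, b, c}. y \<le> c} = k)"
  by (auto simp: red_def Cons_eq_map_conv map_eq_Cons_conv)

lemma Collect_le_triple:
  "{y \<in> {a, b, c}. y \<le> (x::int)} = (if a \<le> x then {a} else {}) \<union> (if b \<le> x then {b} else {}) \<union>
     (if c \<le> x then {c} else {})"
  by auto

lemma red_321: "red u = [3, 2, 1] \<longleftrightarrow> (\<exists>a b c. u = [a, b, c] \<and> a > b \<and> b > c)"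
  unfolding red_triple Collect_le_triple
  apply (intro ex_cong1)
  apply (rule conj_cong[OF refl])
  subgoal for a b c
    by (cases a b rule: linorder_cases; cases b c rule: linorder_cases; cases a c rule: linorder_cases)
       (auto simp: card_insert_if)
  done

lemma red_132: "red u = [1, 3, 2] \<longleftrightarrow> (\<exists>a b c. u = [a, b, c] \<and> a < c \<and> c < b)"
  unfolding red_triple Collect_le_triple
  apply (intro ex_cong1)
  apply (rule conj_cong[OF refl])
  subgoal for a b c
    by (cases a b rule: linorder_cases; cases b c rule: linorder_cases; cases a c rule: linorder_cases)
       (auto simp: card_insert_if)
  done

lemma avoids_321: "avoids w [3, 2, 1] \<longleftrightarrow> av (>) w"
  unfolding avoids_def av_iff_subseq red_321 Bex_def in_set_subseqs
  by (auto simp: not_le) (metis dual_order.strict_trans not_le)+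

lemma avoids_132: "avoids w [1, 3, 2] \<longleftrightarrow> av (<) w"
  unfolding avoids_def av_iff_subseq red_132 Bex_def in_set_subseqs
  by (auto simp: not_le) (metis dual_order.strict_trans not_le)+

section \<open>Monotone and antitone images\<close>

lemma sorted_map_iff:
  assumes "\<And>x y. x \<in> set xs \<Longrightarrow> y \<in> set xs \<Longrightarrow> f x \<le> f y \<longleftrightarrow> x \<le> y"
  shows "sorted (map f xs) \<longleftrightarrow> sorted xs"
  using assms by (induction xs) auto

lemma av_map:
  assumes "\<And>x y. x \<in> set xs \<Longrightarrow> y \<in> set xs \<Longrightarrow> f x \<le> f y \<longleftrightarrow> x \<le> y"
    and "\<And>x y. x \<in> set xs \<Longrightarrow> y \<in> set xs \<Longrightarrow> r' (f x) (f y) \<longleftrightarrow> r x y"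
  shows "av r' (map f xs) \<longleftrightarrow> av r xs"
  using assms
proof (induction xs)
  case (Cons x xs)
  have eq: "filter (r' (f x)) (map f xs) = map f (filter (r x) xs)"
    unfolding filter_map by (rule arg_cong[where f = "map f"], rule filter_cong) (simp_all add: Cons.prems)
  have "sorted (map f (filter (r x) xs)) = sorted (filter (r x) xs)"
    using Cons.prems(1) by (intro sorted_map_iff) auto
  with Cons eq show ?case by simp
qed auto

lemma inc_suffix_map:
  assumes "\<And>x y. x \<in> set xs \<Longrightarrow> y \<in> set xs \<Longrightarrow> f x \<le> f y \<longleftrightarrow> x \<le> y"
  shows "inc_suffix (map f xs) = inc_suffix xs"
  using assms by (induction xs) (auto simp: sorted_map_iff)

lemma subseq_rev_iff: "subseq (rev xs) (rev ys) \<longleftrightarrow> subseq xs ys"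
proof -
  have *: "subseq (rev xs) (rev ys)" if "subseq xs ys" for xs ys :: "'a list"
    using that by (induction rule: list_emb.induct) (auto intro: subseq_rev_drop_many)
  show ?thesis using *[of xs ys] *[of "rev xs" "rev ys"] by auto
qed

text \<open>Reversing positions and reversing the order each turn 321 into 123, so together they
  preserve 321. This serves both the negation of integer words and the reverse-complement of
  derangements.\<close>

lemma av_gt_rev_map:
  assumes "\<And>x y. x \<in> set xs \<Longrightarrow> y \<in> set xs \<Longrightarrow> f x \<le> f y \<longleftrightarrow> y \<le> x"
  shows "av (>) (rev (map f xs)) \<longleftrightarrow> av (>) xs"
proof -
  have eq: "subseq [a, b, c] (rev (map f xs)) \<longleftrightarrow>
      (\<exists>a' b' c'. subseq [c', b', a'] xs \<and> a = f a' \<and> b = f b' \<and> c = f c')" for a b c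
  proof -
    have "subseq [a, b, c] (rev (map f xs)) \<longleftrightarrow> subseq [c, b, a] (map f xs)"
      using subseq_rev_iff[of "[c, b, a]" "map f xs"] by simp
    also have "\<dots> \<longleftrightarrow> (\<exists>ys. subseq ys xs \<and> [c, b, a] = map f ys)"
      by (metis nths_map subseq_conv_nths)
    also have "\<dots> \<longleftrightarrow> (\<exists>a' b' c'. subseq [c', b', a'] xs \<and> a = f a' \<and> b = f b' \<and> c = f c')"
      by (auto simp: Cons_eq_map_conv)
    finally show ?thesis .
  qed
  have "set ys \<subseteq> set xs" if "subseq ys xs" for ys
    using that unfolding subseq_conv_nths by (auto dest: in_set_nthsD)
  note sub = this
  show ?thesis
    unfolding av_iff_subseq
  proof (intro iffI allI impI)
    fix a b c
    assume L: "\<forall>a b c. subseq [a, b, c] (rev (map f xs)) \<longrightarrow> b < a \<longrightarrow> c < a \<longrightarrow> b \<le> c"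
      and s: "subseq [a, b, c] xs" and "b < a" "c < a"
    from sub[OF s] have in_xs: "a \<in> set xs" "b \<in> set xs" "c \<in> set xs" by auto
    from s have "subseq [f c, f b, f a] (rev (map f xs))" using eq by blast
    with L have "f b < f c \<longrightarrow> f a < f c \<longrightarrow> f b \<le> f a" by blast
    with in_xs show "b \<le> c" using assms \<open>b < a\<close> \<open>c < a\<close> by (meson not_le order_less_le_trans)
  next
    fix a b c
    assume L: "\<forall>a b c. subseq [a, b, c] xs \<longrightarrow> b < a \<longrightarrow> c < a \<longrightarrow> b \<le> c"
      and s: "subseq [a, b, c] (rev (map f xs))" and "b < a" "c < a"
    then obtain a' b' c' where *: "subseq [c', b', a'] xs" "a = f a'" "b = f b'" "c = f c'"
      using eq by blast
    from sub[OF *(1)] have in_xs: "a' \<in> set xs" "b' \<in> set xs" "c' \<in> set xs" by auto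
    from L *(1) have "b' < c' \<longrightarrow> a' < c' \<longrightarrow> b' \<le> a'" by blast
    with in_xs show "b \<le> c" using assms \<open>b < a\<close> \<open>c < a\<close> unfolding *(2-4)
      by (meson not_le order_less_le_trans)
  qed
qed

section \<open>Increasing suffixes of concatenations\<close>

lemma inc_suffix_sorted: "sorted xs \<Longrightarrow> inc_suffix xs = length xs"
  by (cases xs) auto

lemma inc_suffix_append_not_sorted: "\<not> sorted ys \<Longrightarrow> inc_suffix (xs @ ys) = inc_suffix ys"
  by (induction xs) (auto simp: sorted_append)

lemma inc_suffix_append_less:
  "\<forall>x\<in>set xs. \<exists>y\<in>set ys. y < x \<Longrightarrow> inc_suffix (xs @ ys) = inc_suffix ys"
  by (induction xs) (auto simp: sorted_append dest: leD)

lemma inc_suffix_append_greater: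
  assumes "\<forall>x\<in>set xs. \<forall>y\<in>set ys. x \<le> y" "sorted ys"
  shows "inc_suffix (xs @ ys) = inc_suffix xs + length ys"
  using assms by (induction xs) (auto simp: sorted_append inc_suffix_sorted)

lemma inc_suffix_le: "inc_suffix xs \<le> length xs"
  by (induction xs) auto

text \<open>Shortening a sorted suffix keeps it sorted, so \<open>inc_suffix\<close> is a threshold:
  it bounds how many letters may stand behind an inserted extreme letter.\<close>

lemma sorted_drop_iff_inc_suffix:
  "r \<le> length xs \<Longrightarrow> sorted (drop (length xs - r) xs) \<longleftrightarrow> r \<le> inc_suffix xs"
proof (induction xs)
  case (Cons x xs)
  show ?case
  proof (cases "r = length (x # xs)")
    case True
    then show ?thesis using inc_suffix_le[of xs] by auto
  next
    case False
    with Cons.prems have "r \<le> length xs" by simp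
    with Cons show ?thesis by (auto simp: Suc_diff_le sorted_wrt_drop)
  qed
qed auto

text \<open>As \<open>r x z\<close> always fails, \<open>z\<close> can only be the first letter of a
  forbidden triple; as \<open>r z x\<close> always holds, the other two letters may be any inversion
  of \<open>R\<close>.\<close>

lemma av_insert_top:
  assumes "\<forall>x\<in>set L \<union> set R. r z x \<and> \<not> r x z"
  shows "av r (L @ z # R) \<longleftrightarrow> av r (L @ R) \<and> sorted R"
  using assms by (induction L) (auto simp: filter_id_conv[THEN iffD2])

section \<open>The generating trees\<close>

text \<open>Permutations are 0-based from here on: \<open>i\<close> is a fixed point iff \<open>\<sigma> ! i = i\<close>.\<close>

definition av_perms :: "(nat \<Rightarrow> nat \<Rightarrow> bool) \<Rightarrow> nat \<Rightarrow> nat list set" where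
  "av_perms r n = {\<sigma> \<in> permutations_of_set {..<n}. av r \<sigma>}"

definition av_ders :: "(nat \<Rightarrow> nat \<Rightarrow> bool) \<Rightarrow> nat \<Rightarrow> nat list set" where
  "av_ders r n = {\<sigma> \<in> av_perms r n. \<forall>i<n. \<sigma> ! i \<noteq> i}"

lemma av_perms_iff: "\<sigma> \<in> av_perms r n \<longleftrightarrow> distinct \<sigma> \<and> set \<sigma> = {..<n} \<and> av r \<sigma>"
  by (auto simp: av_perms_def permutations_of_set_def)

lemma length_av_perms: "\<sigma> \<in> av_perms r n \<Longrightarrow> length \<sigma> = n"
  by (metis av_perms_iff card_lessThan distinct_card)

lemma finite_av_perms [simp]: "finite (av_perms r n)"
  by (simp add: av_perms_def)

lemma finite_av_ders [simp]: "finite (av_ders r n)"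
  by (simp add: av_ders_def)

lemma av_perms_0: "av_perms r 0 = {[]}"
  by (auto simp: av_perms_iff)

lemma av_ders_0: "av_ders r 0 = {[]}"
  by (auto simp: av_ders_def av_perms_0)

text \<open>One growth step of the generating tree, for both patterns at once: \<open>f\<close>
  makes room for the new extreme value \<open>z\<close>, which is \<open>0\<close> for
  \<open>(<)\<close> and \<open>n\<close> for \<open>(>)\<close>. The \<open>k\<close> letters to
  the right of \<open>z\<close> must be sorted, whence
  \<open>k \<le> inc_suffix \<sigma>\<close>.\<close>

lemma bij_betw_insert_top:
  fixes f :: "nat \<Rightarrow> nat"
  assumes le: "\<And>x y. x < n \<Longrightarrow> y < n \<Longrightarrow> f x \<le> f y \<longleftrightarrow> x \<le> y"
    and r: "\<And>x y. x < n \<Longrightarrow> y < n \<Longrightarrow> r (f x) (f y) \<longleftrightarrow> r x y"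
    and z: "\<And>x. x < n \<Longrightarrow> r z (f x) \<and> \<not> r (f x) z"
    and img: "insert z (f ` {..<n}) = {..<Suc n}" "z \<notin> f ` {..<n}"
  shows "bij_betw (\<lambda>(\<sigma>, k). map f (take (n - k) \<sigma>) @ z # map f (drop (n - k) \<sigma>))
           (SIGMA \<sigma>:av_perms r n. {..inc_suffix \<sigma>}) (av_perms r (Suc n))"
    (is "bij_betw ?F ?A ?B")
proof (rule bij_betw_imageI)
  have inj_f: "inj_on f {..<n}"
    using le by (auto simp: inj_on_def) (metis nle_le)
  show "inj_on ?F ?A"
  proof (rule inj_onI)
    fix p p' assume "p \<in> ?A" "p' \<in> ?A" and FF: "?F p = ?F p'"
    then obtain \<sigma> k \<tau> l where p: "p = (\<sigma>, k)" "p' = (\<tau>, l)"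
      and \<sigma>: "\<sigma> \<in> av_perms r n" and \<tau>: "\<tau> \<in> av_perms r n"
      and k: "k \<in> {..inc_suffix \<sigma>}" and l: "l \<in> {..inc_suffix \<tau>}"
      by blast
    with FF have eq: "map f (take (n - k) \<sigma>) @ z # map f (drop (n - k) \<sigma>) =
        map f (take (n - l) \<tau>) @ z # map f (drop (n - l) \<tau>)"
      by simp
    have sets: "set \<sigma> = {..<n}" "set \<tau> = {..<n}" using \<sigma> \<tau> by (auto simp: av_perms_iff)
    have len: "length \<sigma> = n" "length \<tau> = n" using \<sigma> \<tau> length_av_perms by auto
    have "z \<notin> set (map f (take (n - k) \<sigma>))" "z \<notin> set (map f (drop (n - k) \<sigma>))"
      using img(2) sets by (auto dest: in_set_takeD in_set_dropD)
    with eq have eqs: "map f (take (n - k) \<sigma>) = map f (take (n - l) \<tau>)"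
      "map f (drop (n - k) \<sigma>) = map f (drop (n - l) \<tau>)"
      by (auto simp: append_Cons_eq_iff)
    then have "map f \<sigma> = map f \<tau>"
      by (metis append_take_drop_id map_append)
    then have "\<sigma> = \<tau>"
      using inj_f sets by (metis inj_on_map_eq_map sup.idem)
    moreover have "k \<le> n" "l \<le> n"
      using k l inc_suffix_le[of \<sigma>] inc_suffix_le[of \<tau>] len by auto
    moreover have "n - k = n - l"
      using arg_cong[OF eqs(1), of length] len by simp
    ultimately show "p = p'" using p by simp
  qed
  show "?F ` ?A = ?B"
  proof (intro equalityI subsetI)
    fix \<pi> assume "\<pi> \<in> ?F ` ?A"
    then obtain \<sigma> k where \<sigma>: "\<sigma> \<in> av_perms r n" and k: "k \<le> inc_suffix \<sigma>"
      and \<pi>: "\<pi> = map f (take (n - k) \<sigma>) @ z # map f (drop (n - k) \<sigma>)" by auto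
    have len: "length \<sigma> = n" and set: "set \<sigma> = {..<n}" and dist: "distinct \<sigma>" and av: "av r \<sigma>"
      using \<sigma> length_av_perms by (auto simp: av_perms_iff)
    have sub: "set (take (n - k) \<sigma>) \<subseteq> {..<n}" "set (drop (n - k) \<sigma>) \<subseteq> {..<n}"
      using set by (auto dest: in_set_takeD in_set_dropD)
    have "mset \<pi> = add_mset z (mset (map f \<sigma>))"
      unfolding \<pi> by (metis append_take_drop_id map_append mset.simps(2) mset_append union_mset_add_mset_right)
    moreover have "distinct (z # map f \<sigma>)"
      using img(2) dist inj_f set by (auto simp: distinct_map)
    ultimately have "distinct \<pi>" "set \<pi> = {..<Suc n}"
      using img(1) set by (metis mset.simps(2) mset_eq_imp_distinct_iff,
        metis list.set_map list.simps(15) mset.simps(2) mset_eq_setD)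
    moreover have "sorted (drop (n - k) \<sigma>)"
      using sorted_drop_iff_inc_suffix[of k \<sigma>] k inc_suffix_le[of \<sigma>] len by auto
    then have "sorted (map f (drop (n - k) \<sigma>))"
      using sub le by (subst sorted_map_iff) (auto simp: subset_iff)
    moreover have "av r (map f (take (n - k) \<sigma>) @ map f (drop (n - k) \<sigma>))"
      unfolding map_append[symmetric] append_take_drop_id
      using av set le r by (subst av_map) auto
    ultimately show "\<pi> \<in> ?B"
      using z sub unfolding av_perms_iff \<pi> by (subst av_insert_top) auto
  next
    fix \<pi> assume \<pi>: "\<pi> \<in> ?B"
    then have "z \<in> set \<pi>" using img(1) by (auto simp: av_perms_iff)
    then obtain L R where LR: "\<pi> = L @ z # R" by (meson split_list)
    with \<pi> have dist: "distinct (L @ R)" and zz: "z \<notin> set (L @ R)" "insert z (set (L @ R)) = {..<Suc n}"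
      by (auto simp: av_perms_iff)
    have setLR: "set (L @ R) = f ` {..<n}"
      using insert_ident[OF zz(1) img(2)] zz(2) img(1) by simp
    then obtain \<sigma> where \<sigma>: "L @ R = map f \<sigma>" "set \<sigma> \<subseteq> {..<n}"
      using lists_image[of f "{..<n}"] unfolding lists_eq_set by blast
    have top: "\<forall>x\<in>set L \<union> set R. r z x \<and> \<not> r x z" using z setLR by auto
    have "av r (L @ z # R)" using \<pi> LR by (simp add: av_perms_iff)
    then have av: "av r (L @ R)" and sort: "sorted R"
      using av_insert_top[OF top] by auto
    have "set \<sigma> = {..<n}"
      using \<sigma> setLR inj_f by (metis inj_on_image_eq_iff list.set_map subset_refl)
    moreover have "distinct \<sigma>" using dist \<sigma> by (simp add: distinct_map)
    moreover have "av r \<sigma>" using av \<sigma> le r by (subst (asm) \<sigma>(1), subst (asm) av_map) (auto simp: subset_iff)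
    ultimately have \<sigma>_in: "\<sigma> \<in> av_perms r n" by (simp add: av_perms_iff)
    then have len: "length \<sigma> = n" by (rule length_av_perms)
    with \<sigma>(1) have lens: "length L + length R = n" by (metis length_append length_map)
    have L: "L = map f (take (n - length R) \<sigma>)" and R: "R = map f (drop (n - length R) \<sigma>)"
      using \<sigma>(1) lens by (metis add_diff_cancel_right' append_eq_conv_conj take_map,
        metis add_diff_cancel_right' append_eq_conv_conj drop_map)
    have "sorted (drop (n - length R) \<sigma>)"
      using sort \<sigma>(2) le by (subst (asm) R, subst (asm) sorted_map_iff) (auto simp: subset_iff dest!: in_set_dropD)
    then have "length R \<le> inc_suffix \<sigma>"
      using sorted_drop_iff_inc_suffix[of "length R" \<sigma>] len lens by simp
    with \<sigma>_in L R LR show "\<pi> \<in> ?F ` ?A"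
      by (intro image_eqI[where x = "(\<sigma>, length R)"]) auto
  qed
qed

text \<open>The inserted \<open>0\<close> is followed by \<open>k\<close> increasing letters and
  lies below everything in front of it, so the longest increasing suffix starts exactly
  there.\<close>

lemma sum_av_perms_lt_Suc:
  "(\<Sum>\<sigma>\<in>av_perms (<) (Suc n). g (inc_suffix \<sigma>)) =
   (\<Sum>\<sigma>\<in>av_perms (<) n. \<Sum>k\<le>inc_suffix \<sigma>. g (Suc k) :: 'a :: comm_monoid_add)"
proof -
  let ?F = "\<lambda>(\<sigma>, k). map Suc (take (n - k) \<sigma>) @ 0 # map Suc (drop (n - k) \<sigma>)"
  have bij: "bij_betw ?F (SIGMA \<sigma>:av_perms (<) n. {..inc_suffix \<sigma>}) (av_perms (<) (Suc n))"
    by (rule bij_betw_insert_top) (auto simp: lessThan_Suc_eq_insert_0)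
  have "inc_suffix (?F (\<sigma>, k)) = Suc k"
    if "\<sigma> \<in> av_perms (<) n" "k \<le> inc_suffix \<sigma>" for \<sigma> k
  proof -
    have len: "length \<sigma> = n" using that length_av_perms by blast
    have k: "k \<le> n" using that(2) inc_suffix_le[of \<sigma>] len by simp
    have "sorted (drop (n - k) \<sigma>)"
      using sorted_drop_iff_inc_suffix[of k \<sigma>] k len that by simp
    then have "sorted (0 # map Suc (drop (n - k) \<sigma>))" by (simp add: sorted_map_iff)
    with k len show ?thesis
      by (auto simp: inc_suffix_append_less inc_suffix_sorted)
  qed
  then have "(\<Sum>\<sigma>\<in>av_perms (<) (Suc n). g (inc_suffix \<sigma>)) =
      (\<Sum>(\<sigma>, k)\<in>(SIGMA \<sigma>:av_perms (<) n. {..inc_suffix \<sigma>}). g (Suc k))"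
    unfolding sum.reindex_bij_betw[OF bij, symmetric] by (intro sum.cong) auto
  then show ?thesis by (simp add: sum.Sigma)
qed

text \<open>Appending the maximum lengthens the suffix by one; put before \<open>k > 0\<close>
  letters it cuts the suffix down to these. The children have labels
  \<open>s + 1, 1, ..., s\<close>, the same multiset as for \<open>(<)\<close>.\<close>

lemma sum_av_perms_gt_Suc:
  "(\<Sum>\<sigma>\<in>av_perms (>) (Suc n). g (inc_suffix \<sigma>)) =
   (\<Sum>\<sigma>\<in>av_perms (>) n. \<Sum>k\<le>inc_suffix \<sigma>. g (Suc k) :: 'a :: comm_monoid_add)"
proof -
  have shift: "(\<Sum>k\<le>s. g (if k = 0 then Suc s else k)) = (\<Sum>k\<le>s. g (Suc k))" for s
  proof (cases s)
    case (Suc m)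
    show ?thesis
      unfolding Suc sum.atMost_Suc_shift[of "\<lambda>k. g (if k = 0 then Suc (Suc m) else k)"]
      by (simp add: add.commute)
  qed simp
  let ?F = "\<lambda>(\<sigma>, k). map (\<lambda>x. x) (take (n - k) \<sigma>) @ n # map (\<lambda>x. x) (drop (n - k) \<sigma>)"
  have bij: "bij_betw ?F (SIGMA \<sigma>:av_perms (>) n. {..inc_suffix \<sigma>}) (av_perms (>) (Suc n))"
    by (rule bij_betw_insert_top) auto
  have "inc_suffix (?F (\<sigma>, k)) = (if k = 0 then Suc (inc_suffix \<sigma>) else k)"
    if "\<sigma> \<in> av_perms (>) n" "k \<le> inc_suffix \<sigma>" for \<sigma> k
  proof -
    have len: "length \<sigma> = n" using that length_av_perms by blast
    have set: "set \<sigma> = {..<n}" using that by (simp add: av_perms_iff)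
    have k: "k \<le> n" using that(2) inc_suffix_le[of \<sigma>] len by simp
    have sort: "sorted (drop (n - k) \<sigma>)"
      using sorted_drop_iff_inc_suffix[of k \<sigma>] k len that by simp
    show ?thesis
    proof (cases "k = 0")
      case True
      with len set show ?thesis by (simp add: inc_suffix_append_greater less_imp_le)
    next
      case False
      with k len have ne: "drop (n - k) \<sigma> \<noteq> []" by simp
      then have "\<exists>y\<in>set (drop (n - k) \<sigma>). y < n"
        using set by (metis in_set_dropD lessThan_iff list.set_sel(1))
      then have ns: "\<not> sorted (n # drop (n - k) \<sigma>)" by (auto simp: not_le)
      then have "inc_suffix (take (n - k) \<sigma> @ n # drop (n - k) \<sigma>) = inc_suffix (drop (n - k) \<sigma>)"
        using inc_suffix_append_not_sorted[OF ns] by (simp only: inc_suffix.simps if_False)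
      with False k len sort show ?thesis by (simp add: inc_suffix_sorted)
    qed
  qed
  then have "(\<Sum>\<sigma>\<in>av_perms (>) (Suc n). g (inc_suffix \<sigma>)) =
      (\<Sum>(\<sigma>, k)\<in>(SIGMA \<sigma>:av_perms (>) n. {..inc_suffix \<sigma>}).
         g (if k = 0 then Suc (inc_suffix \<sigma>) else k))"
    unfolding sum.reindex_bij_betw[OF bij, symmetric] by (intro sum.cong) auto
  also have "\<dots> = (\<Sum>\<sigma>\<in>av_perms (>) n. \<Sum>k\<le>inc_suffix \<sigma>.
         g (if k = 0 then Suc (inc_suffix \<sigma>) else k))"
    by (simp add: sum.Sigma)
  finally show ?thesis by (simp only: shift)
qed

section \<open>321-avoiding permutations and fixed points\<close>

lemma av_gt_append:
  "\<forall>x\<in>set xs. \<forall>y\<in>set ys. x < y \<Longrightarrow> av (>) (xs @ ys) \<longleftrightarrow> av (>) xs \<and> av (>) ys"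
proof (induction xs)
  case (Cons x xs)
  then have "filter ((>) x) ys = []" by (auto simp: filter_empty_conv not_less less_imp_le)
  with Cons show ?case by simp
qed simp

text \<open>If some \<open>x > i\<close> stood before the fixed point, the values below
  \<open>i\<close> could not all fit in front of it; a displaced value \<open>y\<close> would
  follow, making \<open>x, i, y\<close> a 321 pattern.\<close>

lemma av_gt_fixed_point:
  assumes \<sigma>: "\<sigma> \<in> av_perms (>) n" and i: "i < n" "\<sigma> ! i = i"
  shows "set (take i \<sigma>) = {..<i}"
proof -
  have len: "length \<sigma> = n" and set: "set \<sigma> = {..<n}" and dist: "distinct \<sigma>" and av: "av (>) \<sigma>"
    using \<sigma> length_av_perms by (auto simp: av_perms_iff)
  have split: "\<sigma> = take i \<sigma> @ i # drop (Suc i) \<sigma>"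
    using i len by (metis id_take_nth_drop)
  have card: "card (set (take i \<sigma>)) = i"
    using dist len i by (simp add: distinct_card)
  have "set (take i \<sigma>) \<subseteq> {..<i}"
  proof (rule ccontr)
    assume "\<not> set (take i \<sigma>) \<subseteq> {..<i}"
    then obtain x where x: "x \<in> set (take i \<sigma>)" "i \<le> x" by (meson lessThan_iff not_less subsetI)
    have "i \<notin> set (take i \<sigma>)" using dist split
      by (metis distinct_append disjoint_iff list.set_intros(1))
    with x have "i < x" by (metis le_neq_implies_less)
    have "\<not> {..<i} \<subseteq> set (take i \<sigma>)"
    proof
      assume "{..<i} \<subseteq> set (take i \<sigma>)"
      with x have "insert x {..<i} \<subseteq> set (take i \<sigma>)" by simp
      then have "card (insert x {..<i}) \<le> i" using card by (metis card_mono finite_set)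
      with x show False by simp
    qed
    then obtain y where y: "y < i" "y \<notin> set (take i \<sigma>)" by auto
    then have "y \<in> set \<sigma>" using set i by simp
    with y split have "y \<in> set (drop (Suc i) \<sigma>)"
      by (metis Un_iff less_irrefl set_ConsD set_append)
    then have "subseq ([x] @ [i, y]) (take i \<sigma> @ i # drop (Suc i) \<sigma>)"
      using x by (intro list_emb_append_mono) (auto simp: subseq_singleton_left)
    with split have "subseq [x, i, y] \<sigma>" by simp
    with av \<open>i < x\<close> y show False unfolding av_iff_subseq by fastforce
  qed
  with card show ?thesis by (metis card_lessThan card_subset_eq finite_lessThan)
qed

text \<open>Here \<open>k\<close> is the largest fixed point. What precedes it is an arbitrary
  avoiding permutation of the smaller values; what follows has no fixed point by maximality. No 321
  can cross a direct sum.\<close>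

lemma bij_betw_gt_fixed_point:
  "bij_betw (\<lambda>(k, \<alpha>, \<beta>). \<alpha> @ k # map ((+) (Suc k)) \<beta>)
     (SIGMA k:{..<n}. av_perms (>) k \<times> av_ders (>) (n - Suc k))
     (av_perms (>) n - av_ders (>) n)"
    (is "bij_betw ?F ?A ?B")
proof (rule bij_betw_imageI)
  have facts: "length \<alpha> = k" "length \<beta> = n - Suc k" "k < n" "set \<alpha> = {..<k}"
    "set \<beta> = {..<n - Suc k}" "\<And>i. i < n - Suc k \<Longrightarrow> \<beta> ! i \<noteq> i"
    if "(k, \<alpha>, \<beta>) \<in> ?A" for k \<alpha> \<beta>
    using that by (auto simp: av_ders_def length_av_perms) (auto simp: av_perms_iff)
  \<comment> \<open>A fixed point to the right of position \<open>k\<close> would shift back to a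
    fixed point of the derangement \<beta>. Hence \<open>k\<close> can be read off the
    image.\<close>
  have largest: "j < k" if "(k, \<alpha>, \<beta>) \<in> ?A" "j < n" "?F (k, \<alpha>, \<beta>) ! j = j" "j \<noteq> k" for k \<alpha> \<beta> j
  proof (rule ccontr)
    assume "\<not> j < k"
    with that(4) have "Suc k \<le> j" by simp
    then obtain i where j: "j = Suc k + i" using le_Suc_ex by blast
    note f = facts[OF that(1)]
    have "i < n - Suc k" using that(2) j by simp
    with that(3) f(1,2) have "\<beta> ! i = i" by (simp add: j nth_append)
    with f(6) \<open>i < n - Suc k\<close> show False by blast
  qed
  show "inj_on ?F ?A"
  proof (rule inj_onI)
    fix p p' assume pA: "p \<in> ?A" "p' \<in> ?A" and FF: "?F p = ?F p'"
    obtain k \<alpha> \<beta> l \<gamma> \<delta> where p: "p = (k, \<alpha>, \<beta>)" "p' = (l, \<gamma>, \<delta>)" by (metis prod.exhaust)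
    note f = facts[OF pA(1)[unfolded p]] and f' = facts[OF pA(2)[unfolded p]]
    have "?F p ! k = k" "?F p' ! l = l" using f(1) f'(1) by (auto simp: p nth_append)
    then have "l \<noteq> k \<Longrightarrow> l < k" "l \<noteq> k \<Longrightarrow> k < l"
      using largest[OF pA(1)[unfolded p] f'(3)] largest[OF pA(2)[unfolded p] f(3)] FF p by auto
    then have "k = l" by fastforce
    with FF f f' show "p = p'" by (auto simp: p map_inj_on inj_on_def dest!: map_inj_on)
  qed
  show "?F ` ?A = ?B"
  proof (intro equalityI subsetI)
    fix \<pi> assume "\<pi> \<in> ?F ` ?A"
    then obtain k \<alpha> \<beta> where \<pi>: "\<pi> = \<alpha> @ k # map ((+) (Suc k)) \<beta>"
      and A: "(k, \<alpha>, \<beta>) \<in> ?A" by auto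
    note f = facts[OF A]
    have k: "k < n" and \<alpha>: "\<alpha> \<in> av_perms (>) k" and \<beta>: "\<beta> \<in> av_perms (>) (n - Suc k)"
      using A by (auto simp: av_ders_def)
    have img: "(+) (Suc k) ` {..<n - Suc k} = {Suc k..<n}"
      using k image_add_atLeastLessThan[of "Suc k" 0 "n - Suc k"]
      by (simp add: atLeast0LessThan)
    have "set \<pi> = {..<n}"
      using f(4,5) img k by (auto simp: \<pi>)
    moreover have "distinct \<pi>"
      using \<alpha> \<beta> f(4,5) by (auto simp: \<pi> av_perms_iff distinct_map)
    moreover have "av (>) (map ((+) (Suc k)) \<beta>)"
      using \<beta> by (subst av_map) (auto simp: av_perms_iff)
    then have "av (>) \<pi>"
      using \<alpha> f(4,5) unfolding \<pi>
      by (subst av_gt_append) (auto simp: av_perms_iff filter_empty_conv)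
    ultimately have "\<pi> \<in> av_perms (>) n" by (simp add: av_perms_iff)
    moreover have "\<pi> ! k = k" using f(1) by (simp add: \<pi> nth_append)
    ultimately show "\<pi> \<in> ?B" using k by (auto simp: av_ders_def)
  next
    fix \<pi> assume \<pi>B: "\<pi> \<in> ?B"
    then have \<pi>: "\<pi> \<in> av_perms (>) n" and fix_: "\<exists>i. i < n \<and> \<pi> ! i = i" by (auto simp: av_ders_def)
    have len: "length \<pi> = n" and set: "set \<pi> = {..<n}" and dist: "distinct \<pi>" and av: "av (>) \<pi>"
      using \<pi> length_av_perms by (auto simp: av_perms_iff)
    define k where "k = (GREATEST i. i < n \<and> \<pi> ! i = i)"
    have k: "k < n" "\<pi> ! k = k"
      using GreatestI_ex_nat[OF fix_, of n] by (auto simp: k_def)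
    have k_max: "j \<le> k" if "j < n" "\<pi> ! j = j" for j
      unfolding k_def using that by (intro Greatest_le_nat[where b = n]) auto
    have split: "\<pi> = take k \<pi> @ k # drop (Suc k) \<pi>"
      using k len by (metis id_take_nth_drop)
    have tk: "set (take k \<pi>) = {..<k}" by (rule av_gt_fixed_point[OF \<pi> k])
    have dr: "set (drop (Suc k) \<pi>) = {Suc k..<n}"
    proof -
      have *: "set b = set (a @ x # b) - set a - {x}" if "distinct (a @ x # b)"
        for a b and x :: nat
        using that by auto
      have "set (drop (Suc k) \<pi>) = {..<n} - {..<k} - {k}"
        using *[of "take k \<pi>" k "drop (Suc k) \<pi>"] split dist set tk by simp
      also have "\<dots> = {Suc k..<n}" by auto
      finally show ?thesis .
    qed
    define \<beta> where "\<beta> = map (\<lambda>x. x - Suc k) (drop (Suc k) \<pi>)"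
    have \<beta>: "map ((+) (Suc k)) \<beta> = drop (Suc k) \<pi>"
      using dr unfolding \<beta>_def map_map by (intro map_idI) auto
    have len_\<beta>: "length \<beta> = n - Suc k" by (simp add: \<beta>_def len)
    have "av (>) (take k \<pi> @ k # drop (Suc k) \<pi>)" using av split by simp
    then have avs: "av (>) (take k \<pi>)" "av (>) (drop (Suc k) \<pi>)"
      using tk dr by (auto simp: av_gt_append)
    then have "av (>) (map ((+) (Suc k)) \<beta>)" by (simp add: \<beta>)
    then have "av (>) \<beta>" by (subst (asm) av_map) auto
    moreover have "set \<beta> = {..<n - Suc k}"
      unfolding \<beta>_def set_map dr by (auto simp: image_iff intro!: bexI[of _ "_ + Suc k"])
    moreover have "distinct \<beta>"
      using dist by (metis \<beta> distinct_drop distinct_map)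
    moreover have "\<beta> ! i \<noteq> i" if "i < n - Suc k" for i
    proof
      assume "\<beta> ! i = i"
      moreover have lt: "i + Suc k < n" using that by simp
      ultimately have "\<pi> ! (i + Suc k) = i + Suc k"
        using arg_cong[OF \<beta>, of "\<lambda>l. l ! i"] len_\<beta> len that by (simp add: add.commute)
      with k_max[OF lt] show False by simp
    qed
    ultimately have "\<beta> \<in> av_ders (>) (n - Suc k)" by (simp add: av_ders_def av_perms_iff)
    moreover have "take k \<pi> \<in> av_perms (>) k"
      using tk avs dist by (simp add: av_perms_iff)
    ultimately show "\<pi> \<in> ?F ` ?A"
      using k split \<beta> by (intro image_eqI[where x = "(k, take k \<pi>, \<beta>)"]) auto
  qed
qed

text \<open>A sorted permutation is the identity, so a nonempty derangement has a descent and the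
  suffix stays inside it. If \<beta> is empty, the fixed point is a final maximum and extends the
  suffix of \<alpha>.\<close>

lemma inc_suffix_gt_fixed_point:
  assumes "\<alpha> \<in> av_perms (>) k" "\<beta> \<in> av_ders (>) m"
  shows "inc_suffix (\<alpha> @ k # map ((+) (Suc k)) \<beta>) =
    (if m = 0 then Suc (inc_suffix \<alpha>) else inc_suffix \<beta>)"
proof (cases "m = 0")
  case True
  with assms show ?thesis
    by (auto simp: av_ders_0 av_perms_iff inc_suffix_append_greater less_imp_le)
next
  case False
  have \<beta>: "distinct \<beta>" "set \<beta> = {..<m}" "length \<beta> = m" "\<beta> ! 0 \<noteq> 0"
    using assms(2) False by (auto simp: av_ders_def av_perms_iff length_av_perms)
  have "\<not> sorted \<beta>"
  proof
    assume "sorted \<beta>"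
    then have "\<beta> = sorted_list_of_set {..<m}" using \<beta> by (metis sorted_list_of_set.idem_if_sorted_distinct)
    then have "\<beta> = [0..<m]" by (simp add: lessThan_atLeast0)
    with \<beta> False show False by simp
  qed
  then have "\<not> sorted (map ((+) (Suc k)) \<beta>)" by (subst sorted_map_iff) auto
  then have "inc_suffix ((\<alpha> @ [k]) @ map ((+) (Suc k)) \<beta>) = inc_suffix (map ((+) (Suc k)) \<beta>)"
    by (rule inc_suffix_append_not_sorted)
  also have "\<dots> = inc_suffix \<beta>" by (rule inc_suffix_map) auto
  finally show ?thesis using False by simp
qed

lemma sum_av_perms_gt_fixed_point:
  "(\<Sum>\<sigma>\<in>av_perms (>) n. g (inc_suffix \<sigma>)) =
   (\<Sum>\<sigma>\<in>av_ders (>) n. g (inc_suffix \<sigma>)) +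
   (\<Sum>k<n. \<Sum>\<alpha>\<in>av_perms (>) k. \<Sum>\<beta>\<in>av_ders (>) (n - Suc k).
      g (if n - Suc k = 0 then Suc (inc_suffix \<alpha>) else inc_suffix \<beta>) :: 'a :: comm_monoid_add)"
proof -
  have "(\<Sum>\<sigma>\<in>av_perms (>) n. g (inc_suffix \<sigma>)) =
     (\<Sum>\<sigma>\<in>av_perms (>) n - av_ders (>) n. g (inc_suffix \<sigma>)) + (\<Sum>\<sigma>\<in>av_ders (>) n. g (inc_suffix \<sigma>))"
    by (rule sum.subset_diff) (auto simp: av_ders_def)
  also have "(\<Sum>\<sigma>\<in>av_perms (>) n - av_ders (>) n. g (inc_suffix \<sigma>)) =
     (\<Sum>(k, \<alpha>, \<beta>)\<in>(SIGMA k:{..<n}. av_perms (>) k \<times> av_ders (>) (n - Suc k)).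
       g (if n - Suc k = 0 then Suc (inc_suffix \<alpha>) else inc_suffix \<beta>))"
    unfolding sum.reindex_bij_betw[OF bij_betw_gt_fixed_point, symmetric]
    by (intro sum.cong refl) (auto simp del: map_eq_conv simp: inc_suffix_gt_fixed_point)
  also have "\<dots> = (\<Sum>k<n. \<Sum>\<alpha>\<in>av_perms (>) k. \<Sum>\<beta>\<in>av_ders (>) (n - Suc k).
      g (if n - Suc k = 0 then Suc (inc_suffix \<alpha>) else inc_suffix \<beta>))"
    by (simp add: sum.Sigma sum.cartesian_product)
  finally show ?thesis by (simp add: add.commute)
qed

section \<open>132-avoiding permutations and fixed points\<close>

text \<open>Says that a nonempty block of values and positions \<open>a, \<dots>, a + k\<close> can be inserted into \<open>\<tau>\<close> at
  position \<open>a\<close> without creating a 132 pattern, so that no fixed point arises left of the block.\<close>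

definition splits_at :: "nat list \<Rightarrow> nat \<Rightarrow> bool" where
  "splits_at \<tau> a \<longleftrightarrow> a \<le> length \<tau> \<and> (\<forall>x\<in>set (take a \<tau>). a \<le> x) \<and>
     sorted (filter ((\<le>) a) (drop a \<tau>))"

lemma av_suffix: "av r (xs @ y # ys) \<Longrightarrow> sorted (filter (r y) ys)"
  by (induction xs) auto

lemma sorted_filter_mono: "sorted (filter P xs) \<Longrightarrow> (\<And>x. Q x \<Longrightarrow> P x) \<Longrightarrow> sorted (filter Q xs)"
  using sorted_wrt_filter[of "(\<le>)" "filter P xs" Q] by (simp add: conj_absorb cong: conj_cong)
    (metis (mono_tags, lifting) filter_cong)

text \<open>The place is the largest \<open>a\<close> for which the first \<open>a\<close> entries
  are all at least \<open>a\<close>. Maximality supplies a small letter that, as the first letter of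
  a potential 132, forces the later large entries to increase.\<close>

lemma ex1_splits_at:
  assumes \<tau>: "\<tau> \<in> av_perms (<) m"
  shows "\<exists>!a. splits_at \<tau> a"
proof -
  have len: "length \<tau> = m" and set: "set \<tau> = {..<m}" and av: "av (<) \<tau>"
    using \<tau> length_av_perms by (auto simp: av_perms_iff)
  define P where "P a \<longleftrightarrow> a \<le> m \<and> (\<forall>x\<in>set (take a \<tau>). a \<le> x)" for a
  define a where "a = (GREATEST a. P a)"
  have "P 0" by (simp add: P_def)
  then have Pa: "P a"
    unfolding a_def by (rule GreatestI_nat[where b = m]) (simp add: P_def)
  then have am: "a \<le> m" and Pa': "\<And>x. x \<in> set (take a \<tau>) \<Longrightarrow> a \<le> x" by (auto simp: P_def)
  have a_max: "\<not> P (Suc a)"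
    using Greatest_le_nat[of P "Suc a" m] by (auto simp: a_def[symmetric] P_def)
  have "sorted (filter ((\<le>) a) (drop a \<tau>))"
  proof (cases "a < m")
    case True
    have drop: "drop a \<tau> = \<tau> ! a # drop (Suc a) \<tau>"
      using True len by (simp add: Cons_nth_drop_Suc)
    have take: "take (Suc a) \<tau> = take a \<tau> @ [\<tau> ! a]"
      using True len by (simp add: take_Suc_conv_app_nth)
    \<comment> \<open>The condition fails at \<open>a + 1\<close> for one of two reasons: the value
      \<open>a\<close> occurs among the first \<open>a\<close> entries, or the next entry is at most
      \<open>a\<close>. Either letter plays the 1 of a 132 for the larger entries behind it.\<close>
    show ?thesis
    proof (cases "a \<in> set (take a \<tau>)")
      case True
      then obtain xs ys where xs: "take a \<tau> = xs @ a # ys" by (meson split_list)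
      then have "av (<) (xs @ a # ys @ drop a \<tau>)"
        using av append_take_drop_id[of a \<tau>] by simp
      then have "sorted (filter ((<) a) (ys @ drop a \<tau>))"
        by (rule av_suffix)
      then have "sorted (filter ((<) a) (drop a \<tau>))" by (simp add: sorted_append)
      moreover have "a \<notin> set (drop a \<tau>)"
        using True \<tau> by (metis IntI av_perms_iff empty_iff set_take_disj_set_drop_if_distinct order_refl)
      then have "filter ((\<le>) a) (drop a \<tau>) = filter ((<) a) (drop a \<tau>)"
        by (intro filter_cong refl) (auto simp: le_less)
      ultimately show ?thesis by simp
    next
      case False
      with Pa' have "x \<in> set (take a \<tau>) \<Longrightarrow> Suc a \<le> x" for x by (metis Suc_leI le_neq_implies_less)
      with a_max True take have small: "\<tau> ! a \<le> a" by (auto simp: P_def)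
      have "av (<) (take a \<tau> @ \<tau> ! a # drop (Suc a) \<tau>)"
        using av True len by (metis id_take_nth_drop)
      then have "sorted (filter ((<) (\<tau> ! a)) (drop (Suc a) \<tau>))"
        by (rule av_suffix)
      moreover have "\<tau> ! a \<notin> set (drop (Suc a) \<tau>)"
        using \<tau> drop by (metis av_perms_iff distinct.simps(2) distinct_drop)
      then have "filter ((\<le>) a) (drop (Suc a) \<tau>) = filter (\<lambda>x. a \<le> x \<and> \<tau> ! a < x) (drop (Suc a) \<tau>)"
        using small by (intro filter_cong refl) (auto simp: le_less)
      ultimately have "sorted (filter ((\<le>) a) (drop (Suc a) \<tau>))"
        by (auto elim: sorted_filter_mono)
      with small show ?thesis unfolding drop by auto
    qed
  next
    case False
    then show ?thesis using len by simp
  qed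
  then have ex: "splits_at \<tau> a" using am Pa' len by (simp add: splits_at_def)
  \<comment> \<open>With two places \<open>b < c\<close>, the entry at position \<open>b\<close> is
    at least \<open>c\<close>, while the value \<open>b\<close> is missing from the first
    \<open>c\<close> entries. So \<open>b\<close> comes later and breaks the order required at the
    place \<open>b\<close>.\<close>
  have uniq: "\<not> (splits_at \<tau> b \<and> splits_at \<tau> c \<and> b < c)" for b c
  proof
    assume *: "splits_at \<tau> b \<and> splits_at \<tau> c \<and> b < c"
    then have cm: "c \<le> m" "b < m" and sort: "sorted (filter ((\<le>) b) (drop b \<tau>))"
      and c: "\<And>x. x \<in> set (take c \<tau>) \<Longrightarrow> c \<le> x"
      using len by (auto simp: splits_at_def)
    have drop: "drop b \<tau> = \<tau> ! b # drop (Suc b) \<tau>"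
      using cm len by (simp add: Cons_nth_drop_Suc)
    have "\<tau> ! b \<in> set (take c \<tau>)" using * cm len by (metis in_set_conv_nth length_take min.absorb2 nth_take)
    then have big: "c \<le> \<tau> ! b" by (rule c)
    have "b \<in> set \<tau>" using cm set by simp
    moreover have "b \<notin> set (take c \<tau>)" using c[of b] * by auto
    moreover have "set (take (Suc b) \<tau>) \<subseteq> set (take c \<tau>)" using * by (intro set_take_subset_set_take) auto
    moreover have "set \<tau> = set (take (Suc b) \<tau>) \<union> set (drop (Suc b) \<tau>)"
      by (metis append_take_drop_id set_append)
    ultimately have "b \<in> set (drop (Suc b) \<tau>)" by blast
    then have "\<tau> ! b \<le> b" using sort big * unfolding drop by auto
    with big * show False by simp
  qed
  show ?thesis using ex uniq by (metis linorder_neqE_nat)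
qed

definition splitting_pos :: "nat list \<Rightarrow> nat" where
  "splitting_pos \<tau> = (THE a. splits_at \<tau> a)"

lemma splitting_pos: "\<tau> \<in> av_perms (<) m \<Longrightarrow> splits_at \<tau> (splitting_pos \<tau>)"
  unfolding splitting_pos_def by (rule theI') (rule ex1_splits_at)

lemma splitting_pos_eq: "\<tau> \<in> av_perms (<) m \<Longrightarrow> splits_at \<tau> a \<Longrightarrow> splitting_pos \<tau> = a"
  using ex1_splits_at splitting_pos by blast

section \<open>Inserting a block together with its fixed point\<close>

definition make_room :: "nat \<Rightarrow> nat \<Rightarrow> nat \<Rightarrow> nat" where
  "make_room k a v = (if v < a then v else v + Suc k)"

lemma make_room_le_iff: "make_room k a x \<le> make_room k a y \<longleftrightarrow> x \<le> y"
  by (auto simp: make_room_def)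

lemma make_room_less_iff: "make_room k a x < make_room k a y \<longleftrightarrow> x < y"
  by (auto simp: make_room_def)

lemma inj_make_room: "inj (make_room k a)"
  by (auto simp: inj_def make_room_def split: if_splits)

text \<open>Intended for \<open>length L = a\<close> and \<open>length B = k\<close>: the block then
  fills the values and positions from \<open>a\<close> to \<open>a + k - 1\<close>, and
  \<open>a + k\<close> is a fixed point. The gap opened by \<open>make_room\<close> has
  \<open>Suc k\<close> values because it also holds this fixed point.\<close>

definition insert_block :: "nat \<Rightarrow> nat \<Rightarrow> nat list \<Rightarrow> nat list \<Rightarrow> nat list \<Rightarrow> nat list" where
  "insert_block k a L B R = map (make_room k a) L @ map ((+) a) B @ (a + k) # map (make_room k a) R"

text \<open>After shifting, the letters of \<open>L\<close> exceed the block and the fixed point, so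
  the larger letters behind them are the same as before. The letters of the block and the fixed
  point lie below exactly those letters of \<open>R\<close> that are at least \<open>a\<close>, and
  \<open>a + k\<close> alone already forces these to increase.\<close>

lemma av_insert_block:
  assumes "\<forall>x\<in>set L. a \<le> x" "set B \<subseteq> {..<k}"
  shows "av (<) (insert_block k a L B R) \<longleftrightarrow>
    av (<) (L @ R) \<and> av (<) B \<and> sorted (filter ((\<le>) a) R)"
  using assms unfolding insert_block_def
proof (induction L)
  case Nil
  have big: "filter ((<) (a + x)) (map (make_room k a) R) = map (make_room k a) (filter ((\<le>) a) R)"
    if "x \<le> k" for x
    unfolding filter_map using that
    by (intro arg_cong[where f = "map _"] filter_cong refl) (auto simp: make_room_def)
  have ge: "\<forall>y\<in>set (filter ((\<le>) a) R). a + k < make_room k a y" by (auto simp: make_room_def)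
  show ?case
    using Nil(2)
  proof (induction B)
    case Nil
    show ?case by (simp add: big sorted_map_iff make_room_le_iff av_map make_room_less_iff conj_ac)
  next
    case (Cons x B)
    then have xk: "x < k" "\<forall>y\<in>set B. y < k" by auto
    then have "filter ((<) (a + x)) (map ((+) a) B @ (a + k) # map (make_room k a) R) =
        map ((+) a) (filter ((<) x) B) @ (a + k) # map (make_room k a) (filter ((\<le>) a) R)"
      using big[OF less_imp_le[OF xk(1)]] by (simp add: filter_map o_def)
    moreover have "sorted \<dots> \<longleftrightarrow> sorted (filter ((<) x) B) \<and> sorted (filter ((\<le>) a) R)"
    proof -
      have "\<forall>b\<in>set (map ((+) a) (filter ((<) x) B)).
          \<forall>y\<in>set ((a + k) # map (make_room k a) (filter ((\<le>) a) R)). b \<le> y"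
        using xk by (auto simp: make_room_def intro: less_imp_le)
      then show ?thesis
        using ge by (auto simp: sorted_append sorted_map_iff make_room_le_iff less_imp_le)
    qed
    ultimately show ?case using Cons by auto
  qed
next
  case (Cons l L)
  have "filter ((<) (make_room k a l)) (map (make_room k a) L @ map ((+) a) B @ (a + k) # map (make_room k a) R)
     = map (make_room k a) (filter ((<) l) (L @ R))"
  proof -
    have "make_room k a l = l + Suc k" "a \<le> l" using Cons.prems by (auto simp: make_room_def)
    moreover have "filter ((<) (make_room k a l)) (map ((+) a) B) = []"
      using Cons.prems by (fastforce simp: make_room_def filter_empty_conv)
    moreover have "filter ((<) (make_room k a l)) (map (make_room k a) X) = map (make_room k a) (filter ((<) l) X)" for X
      by (simp add: filter_map o_def make_room_less_iff)
    moreover have "\<not> make_room k a l < a + k" using calculation(1,2) by simp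
    ultimately show ?thesis
      by (simp only: filter_append filter.simps if_False map_append append_Nil)
  qed
  moreover have "sorted (map (make_room k a) (filter ((<) l) (L @ R))) \<longleftrightarrow> sorted (filter ((<) l) (L @ R))"
    by (rule sorted_map_iff) (simp add: make_room_le_iff)
  ultimately show ?case using Cons by simp
qed

lemma make_room_image: "a \<le> m \<Longrightarrow> make_room k a ` {..<m} = {..<a} \<union> {a + Suc k..<m + Suc k}"
proof (intro equalityI subsetI)
  fix x assume "a \<le> m" "x \<in> {..<a} \<union> {a + Suc k..<m + Suc k}"
  then show "x \<in> make_room k a ` {..<m}"
    by (intro image_eqI[where x = "if x < a then x else x - Suc k"]) (auto simp: make_room_def)
qed (auto simp: make_room_def)

lemma insert_block_perm:
  assumes "set (L @ R) = {..<m}" "distinct (L @ R)" "set B = {..<k}" "distinct B" "a \<le> m"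
  shows "set (insert_block k a L B R) = {..<m + Suc k}" "distinct (insert_block k a L B R)"
proof -
  have mr: "set (map (make_room k a) L) \<union> set (map (make_room k a) R) = {..<a} \<union> {a + Suc k..<m + Suc k}"
    using make_room_image[of a m k] assms by (metis image_Un set_append set_map)
  have pl: "set (map ((+) a) B) = {a..<a + k}"
    using assms(3) image_add_atLeastLessThan[of a 0 k] by (simp add: atLeast0LessThan add.commute)
  have "set (insert_block k a L B R) =
      (set (map (make_room k a) L) \<union> set (map (make_room k a) R)) \<union> set (map ((+) a) B) \<union> {a + k}"
    by (auto simp: insert_block_def)
  also have "\<dots> = {..<m + Suc k}"
    unfolding mr pl using assms(5) by auto
  finally show "set (insert_block k a L B R) = {..<m + Suc k}" .
  have "distinct (map (make_room k a) L @ map (make_room k a) R)"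
    using assms(2) inj_make_room[of k a] unfolding map_append[symmetric] distinct_map
    by (auto intro: inj_on_subset)
  moreover have "distinct (map ((+) a) B)" using assms by (simp add: distinct_map)
  moreover have "a + k \<notin> {..<a} \<union> {a + Suc k..<m + Suc k}" "{a..<a + k} \<inter> ({..<a} \<union> {a + Suc k..<m + Suc k}) = {}"
    "a + k \<notin> {a..<a + k}" by auto
  ultimately show "distinct (insert_block k a L B R)"
    using mr pl unfolding insert_block_def distinct_append distinct.simps set_append list.set(2) by blast
qed

text \<open>For sorted \<tau> the place is \<open>0\<close>, so the block comes first, followed by
  larger increasing letters: the fixed point and all of \<tau>. Otherwise the place is positive, so
  \<open>0\<close> lies in the right part of \<tau>, below the left part, the block and the fixed
  point, and the suffix stays in the right part.\<close>

lemma inc_suffix_insert_block: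
  assumes \<tau>: "\<tau> \<in> av_perms (<) m" and a: "a = splitting_pos \<tau>" and B: "set B = {..<k}"
  shows "inc_suffix (insert_block k a (take a \<tau>) B (drop a \<tau>)) =
    (if sorted \<tau> then Suc (inc_suffix B + m) else inc_suffix \<tau>)"
proof -
  have len: "length \<tau> = m" and set: "set \<tau> = {..<m}"
    using \<tau> length_av_perms by (auto simp: av_perms_iff)
  have spl: "splits_at \<tau> a" unfolding a using \<tau> by (rule splitting_pos)
  show ?thesis
  proof (cases "sorted \<tau>")
    case True
    then have "splits_at \<tau> 0" by (simp add: splits_at_def sorted_wrt_filter)
    then have [simp]: "a = 0" using a splitting_pos_eq[OF \<tau>] by simp
    have "sorted (k # map (make_room k 0) \<tau>)"
      using True by (auto simp: sorted_map_iff make_room_le_iff) (simp add: make_room_def)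
    then have "inc_suffix (B @ k # map (make_room k 0) \<tau>) = inc_suffix B + length (k # map (make_room k 0) \<tau>)"
      using B by (intro inc_suffix_append_greater) (auto simp: make_room_def)
    with True len show ?thesis by (simp add: insert_block_def map_idI)
  next
    case False
    have "a \<noteq> 0"
    proof
      assume "a = 0"
      then show False using spl False by (simp add: splits_at_def)
    qed
    have L: "\<forall>x\<in>set (take a \<tau>). a \<le> x" using spl by (simp add: splits_at_def)
    have "m \<noteq> 0" using False len by auto
    then have "0 \<in> set (take a \<tau> @ drop a \<tau>)" using set by simp
    moreover have "0 \<notin> set (take a \<tau>)" using L \<open>a \<noteq> 0\<close> by auto
    ultimately have 0: "0 \<in> set (drop a \<tau>)" by (metis Un_iff set_append)
    then have zero: "0 \<in> set (map (make_room k a) (drop a \<tau>))" using \<open>a \<noteq> 0\<close> by (force simp: make_room_def)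
    have "inc_suffix ((map (make_room k a) (take a \<tau>) @ map ((+) a) B @ [a + k]) @ map (make_room k a) (drop a \<tau>)) =
        inc_suffix (map (make_room k a) (drop a \<tau>))"
      using L \<open>a \<noteq> 0\<close> by (intro inc_suffix_append_less ballI bexI[OF _ zero]) (auto simp: make_room_def)
    also have "\<dots> = inc_suffix (drop a \<tau>)"
      by (rule inc_suffix_map) (simp add: make_room_le_iff)
    also have "\<dots> = inc_suffix (take a \<tau> @ drop a \<tau>)"
      using L \<open>a \<noteq> 0\<close> by (intro inc_suffix_append_less[symmetric] ballI bexI[OF _ 0]) auto
    finally show ?thesis using False by (simp add: insert_block_def)
  qed
qed

section \<open>Recovering the block from a permutation\<close>

lemma filter_split:
  assumes "\<And>x y. subseq [x, y] P \<Longrightarrow> S x \<Longrightarrow> S y"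
  shows "P = filter (\<lambda>x. \<not> S x) P @ filter S P"
  using assms
proof (induction P)
  case (Cons x P)
  have IH: "P = filter (\<lambda>x. \<not> S x) P @ filter S P"
  proof (rule Cons.IH)
    fix y z assume "subseq [y, z] P" "S y"
    then show "S z" using Cons.prems[of y z] by (meson list_emb_Cons)
  qed
  show ?case
  proof (cases "S x")
    case True
    then have "\<forall>y\<in>set P. S y"
      using Cons.prems[of x] by (auto simp: subseq_singleton_left)
    with True show ?thesis by (simp add: filter_id_conv[THEN iffD2] filter_empty_conv)
  next
    case False
    with IH show ?thesis by simp
  qed
qed simp

text \<open>\<open>C\<close> is closed downwards within \<open>{..<i}\<close>, hence an initial
  segment. This will show that the block takes consecutive values just beneath the fixed
  point.\<close>

lemma upper_part_of_lessThan:
  assumes un: "A \<union> C = {..<i :: nat}" and less: "\<And>x y. x \<in> A \<Longrightarrow> y \<in> C \<Longrightarrow> y < x"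
  shows "A = {i - card A..<i}" "C = {..<i - card A}"
proof -
  have fin: "finite A" "finite C" using un by (metis finite_Un finite_lessThan)+
  have dis: "A \<inter> C = {}" using less by fastforce
  have C: "C = {..<card C}"
  proof (cases "C = {}")
    case False
    have "C = {..Max C}"
    proof (intro equalityI subsetI)
      fix y assume "y \<in> {..Max C}"
      moreover have Max: "Max C \<in> C" using False fin by simp
      ultimately have "y \<notin> A" using less[of y "Max C"] by auto
      moreover have "Max C \<in> {..<i}" using Max unfolding un[symmetric] by simp
      then have "y < i" using \<open>y \<in> {..Max C}\<close> by simp
      ultimately show "y \<in> C" using un by blast
    qed (use fin in simp)
    then have "card C = Suc (Max C)" by (metis card_atMost)
    with \<open>C = {..Max C}\<close> show ?thesis by (simp add: lessThan_Suc_atMost)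
  qed simp
  have "card A + card C = i" using card_Un_disjoint[OF fin dis] un by simp
  then have "card C = i - card A" by simp
  with C show CA: "C = {..<i - card A}" by simp
  have "A = {..<i} - C" using un dis by blast
  also have "\<dots> = {i - card A..<i}" by (subst CA) auto
  finally show "A = {i - card A..<i}" .
qed

lemma nth_insert_block:
  assumes "length L = a" "length B = k"
  shows "j < a \<Longrightarrow> insert_block k a L B R ! j = make_room k a (L ! j)"
    "i < k \<Longrightarrow> insert_block k a L B R ! (a + i) = a + B ! i"
    "insert_block k a L B R ! (a + k) = a + k"
  using assms by (auto simp: insert_block_def nth_append)

text \<open>The inserted fixed point is the smallest one. Conversely, in front of the smallest fixed
  point \<open>i\<close> the entries above \<open>i\<close> come first and those below
  \<open>i\<close> form the block; removing the block and \<open>i\<close> leaves a permutation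
  whose unique place is where they stood.\<close>

lemma bij_betw_lt_fixed_point:
  "bij_betw (\<lambda>(k, B, \<tau>). insert_block k (splitting_pos \<tau>) (take (splitting_pos \<tau>) \<tau>) B (drop (splitting_pos \<tau>) \<tau>))
     (SIGMA k:{..<n}. av_ders (<) k \<times> av_perms (<) (n - Suc k))
     (av_perms (<) n - av_ders (<) n)"
    (is "bij_betw ?F ?A ?B")
proof (rule bij_betw_imageI)
  have facts: "length (take (splitting_pos \<tau>) \<tau>) = splitting_pos \<tau>" "length B = k" "k < n" "set B = {..<k}"
    "splitting_pos \<tau> \<le> n - Suc k" "\<And>i. i < k \<Longrightarrow> B ! i \<noteq> i" "set \<tau> = {..<n - Suc k}"
    "\<And>x. x \<in> set (take (splitting_pos \<tau>) \<tau>) \<Longrightarrow> splitting_pos \<tau> \<le> x"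
    "B \<in> av_perms (<) k" "\<tau> \<in> av_perms (<) (n - Suc k)" "splits_at \<tau> (splitting_pos \<tau>)"
    if "(k, B, \<tau>) \<in> ?A" for k B \<tau>
  proof -
    have 1: "B \<in> av_perms (<) k" "\<tau> \<in> av_perms (<) (n - Suc k)" "k < n" "\<And>i. i < k \<Longrightarrow> B ! i \<noteq> i"
      using that by (auto simp: av_ders_def)
    note 2 = splitting_pos[OF 1(2)] length_av_perms[OF 1(2)] length_av_perms[OF 1(1)]
    show "length (take (splitting_pos \<tau>) \<tau>) = splitting_pos \<tau>" "length B = k" "k < n" "set B = {..<k}"
    "splitting_pos \<tau> \<le> n - Suc k" "\<And>i. i < k \<Longrightarrow> B ! i \<noteq> i" "set \<tau> = {..<n - Suc k}"
    "\<And>x. x \<in> set (take (splitting_pos \<tau>) \<tau>) \<Longrightarrow> splitting_pos \<tau> \<le> x"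
    "B \<in> av_perms (<) k" "\<tau> \<in> av_perms (<) (n - Suc k)" "splits_at \<tau> (splitting_pos \<tau>)"
      using 1 2 by (auto simp: splits_at_def av_perms_iff)
  qed
  \<comment> \<open>The entries in front of the block are at least the place and get shifted up, so
    they exceed their positions; the block is a shifted derangement. Thus the image determines the
    sum of the place and \<open>k\<close>.\<close>
  have least: "(LEAST i. ?F (k, B, \<tau>) ! i = i) = splitting_pos \<tau> + k" if A: "(k, B, \<tau>) \<in> ?A" for k B \<tau>
  proof (rule Least_equality)
    note f = facts[OF A]
    let ?a = "splitting_pos \<tau>"
    show "?F (k, B, \<tau>) ! (?a + k) = ?a + k"
      using nth_insert_block(3)[OF f(1,2)] by simp
    fix j assume j: "?F (k, B, \<tau>) ! j = j"
    show "?a + k \<le> j"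
    proof (rule ccontr)
      assume "\<not> ?a + k \<le> j"
      then consider "j < ?a" | i where "j = ?a + i" "i < k"
        by (metis add_less_cancel_left le_Suc_ex not_le)
      then show False
      proof cases
        case 1
        with j f(1) have eq: "make_room k ?a (take ?a \<tau> ! j) = j"
          using nth_insert_block(1)[OF f(1,2) 1] by simp
        have "take ?a \<tau> ! j \<in> set (take ?a \<tau>)" using 1 f(1) by (metis nth_mem)
        then have "?a \<le> take ?a \<tau> ! j" by (rule f(8))
        with eq 1 show False by (simp add: make_room_def)
      next
        case 2
        with j have "B ! i = i" using nth_insert_block(2)[OF f(1,2) 2(2)] by simp
        with f(6) 2 show False by blast
      qed
    qed
  qed
  \<comment> \<open>The entries left of the fixed point that exceed it are exactly those from the
    left part of \<tau>. Their number recovers the place, and then the sum recovers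
    \<open>k\<close>.\<close>
  have before: "card {x \<in> set (take (splitting_pos \<tau> + k) (?F (k, B, \<tau>))). splitting_pos \<tau> + k < x} = splitting_pos \<tau>"
    if A: "(k, B, \<tau>) \<in> ?A" for k B \<tau>
  proof -
    note f = facts[OF A]
    let ?a = "splitting_pos \<tau>"
    have "take (?a + k) (?F (k, B, \<tau>)) = map (make_room k ?a) (take ?a \<tau>) @ map ((+) ?a) B"
      using f(1,2) by (simp add: insert_block_def)
    moreover have "{x \<in> set (map (make_room k ?a) (take ?a \<tau>) @ map ((+) ?a) B). ?a + k < x} =
        make_room k ?a ` set (take ?a \<tau>)"
      using f(4,8) by (fastforce simp: make_room_def)
    moreover have "card (make_room k ?a ` set (take ?a \<tau>)) = ?a"
    proof -
      have "distinct (take ?a \<tau>)" using f(10) by (simp add: av_perms_iff)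
      then show ?thesis using f(1) inj_make_room
        by (metis card_image distinct_card inj_on_subset subset_UNIV)
    qed
    ultimately show ?thesis by simp
  qed
  show "inj_on ?F ?A"
  proof (rule inj_onI)
    fix p p' assume pA: "p \<in> ?A" "p' \<in> ?A" and FF: "?F p = ?F p'"
    obtain k B \<tau> k' B' \<tau>' where p: "p = (k, B, \<tau>)" "p' = (k', B', \<tau>')" by (metis prod.exhaust)
    note A = pA[unfolded p]
    note f = facts[OF A(1)] and f' = facts[OF A(2)]
    have eq: "?F (k, B, \<tau>) = ?F (k', B', \<tau>')" using FF p by simp
    have sum_eq: "splitting_pos \<tau> + k = splitting_pos \<tau>' + k'"
      using least[OF A(1)] least[OF A(2)] eq by simp
    then have a: "splitting_pos \<tau> = splitting_pos \<tau>'"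
      using before[OF A(1)] before[OF A(2)] eq by simp
    with sum_eq have k: "k = k'" by simp
    define a where "a = splitting_pos \<tau>"
    have lens: "length (take a \<tau>) = length (take a \<tau>')" "length B = length B'"
      using f(1,2) f'(1,2) a k by (simp_all only: a_def)
    have "insert_block k a (take a \<tau>) B (drop a \<tau>) = insert_block k a (take a \<tau>') B' (drop a \<tau>')"
      using eq a k by (simp add: a_def)
    then have "map (make_room k a) (take a \<tau>) = map (make_room k a) (take a \<tau>')"
      "map ((+) a) B = map ((+) a) B'" "map (make_room k a) (drop a \<tau>) = map (make_room k a) (drop a \<tau>')"
      using lens by (simp_all add: insert_block_def)
    then have "take a \<tau> = take a \<tau>'" "B = B'" "drop a \<tau> = drop a \<tau>'"
      using inj_make_room[of k a] by (auto simp: inj_map_eq_map)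
    then show "p = p'" using p k by (metis append_take_drop_id)
  qed
  show "?F ` ?A = ?B"
  proof (intro equalityI subsetI)
    fix \<pi> assume "\<pi> \<in> ?F ` ?A"
    then obtain p where p: "\<pi> = ?F p" "p \<in> ?A" by (rule imageE)
    obtain k B \<tau> where "p = (k, B, \<tau>)" by (cases p)
    with p have \<pi>: "\<pi> = ?F (k, B, \<tau>)" and A: "(k, B, \<tau>) \<in> ?A" by simp_all
    note f = facts[OF A]
    define a where "a = splitting_pos \<tau>"
    have \<pi>': "\<pi> = insert_block k a (take a \<tau>) B (drop a \<tau>)" by (simp add: \<pi> a_def)
    have "set \<pi> = {..<n}" "distinct \<pi>"
      using insert_block_perm[of "take a \<tau>" "drop a \<tau>" "n - Suc k" B k a] f unfolding \<pi>'
      by (auto simp: av_perms_iff a_def)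
    moreover have "av (<) \<pi>"
      unfolding \<pi>' using f(4,8,9,10,11) by (subst av_insert_block) (auto simp: av_perms_iff splits_at_def a_def)
    moreover have "\<pi> ! (a + k) = a + k"
      using nth_insert_block(3)[OF f(1,2)] by (simp add: \<pi>' a_def)
    moreover have "a + k < n" using f(3,5) by (simp add: a_def)
    ultimately show "\<pi> \<in> ?B" by (auto simp: av_ders_def av_perms_iff)
  next
    fix \<pi> assume \<pi>B: "\<pi> \<in> ?B"
    then have \<pi>: "\<pi> \<in> av_perms (<) n" and fix_: "\<exists>i. i < n \<and> \<pi> ! i = i" by (auto simp: av_ders_def)
    have len: "length \<pi> = n" and set: "set \<pi> = {..<n}" and dist: "distinct \<pi>" and av: "av (<) \<pi>"
      using \<pi> length_av_perms by (auto simp: av_perms_iff)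
    define i where "i = (LEAST i. i < n \<and> \<pi> ! i = i)"
    have i: "i < n" "\<pi> ! i = i" using LeastI_ex[OF fix_] by (auto simp: i_def)
    have i_min: "j < i \<Longrightarrow> \<pi> ! j \<noteq> j" for j
      using not_less_Least[of j "\<lambda>i. i < n \<and> \<pi> ! i = i"] i(1) by (auto simp: i_def[symmetric])
    define P Q where "P = take i \<pi>" and "Q = drop (Suc i) \<pi>"
    have split: "\<pi> = P @ i # Q" unfolding P_def Q_def
      using i len by (metis id_take_nth_drop)
    have lenP: "length P = i" using i len by (simp add: P_def)
    have no_i: "i \<notin> set P" "i \<notin> set Q" and distPQ: "distinct (P @ Q)"
      using dist unfolding split by auto
    define L' B' where "L' = filter (\<lambda>x. \<not> x < i) P" and "B' = filter (\<lambda>x. x < i) P"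
    \<comment> \<open>If \<open>x < i\<close> stood before some \<open>y > i\<close> within
      \<open>P\<close>, then \<open>x, y, i\<close> would be a 132 pattern.\<close>
    have P: "P = L' @ B'"
      unfolding L'_def B'_def
    proof (rule filter_split)
      fix x y assume xy: "subseq [x, y] P" "x < i"
      have "subseq ([x, y] @ [i]) (P @ i # Q)"
        using xy by (intro list_emb_append_mono) (auto simp: subseq_singleton_left)
      then have "x < y \<longrightarrow> y \<le> i" using av xy(2) unfolding split av_iff_subseq by auto
      moreover have "y \<in> set P"
        using xy(1) unfolding subseq_conv_nths by (metis in_set_nthsD list.set_intros)
      then have "y \<noteq> i" using no_i by blast
      ultimately show "y < i" using xy(2) by linarith
    qed
    define C where "C = {y \<in> set Q. y < i}"
    define k where "k = length B'"
    define a where "a = length L'"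
    have ak: "a + k = i" using lenP by (simp add: P a_def k_def)
    have PQ: "set P \<union> set Q \<union> {i} = {..<n}" using set unfolding split by auto
    have "set B' \<union> C = {x \<in> set P \<union> set Q \<union> {i}. x < i}"
      by (auto simp: B'_def C_def)
    also have "\<dots> = {..<i}" unfolding PQ using i(1) by auto
    finally have un: "set B' \<union> C = {..<i}" .
    \<comment> \<open>Values \<open>x < y < i\<close> with \<open>x\<close> before and
      \<open>y\<close> after the fixed point would give the 132 pattern
      \<open>x, i, y\<close>.\<close>
    have below: "y < x" if "x \<in> set B'" "y \<in> C" for x y
    proof -
      have "subseq ([x] @ [i, y]) (P @ i # Q)"
        using that by (intro list_emb_append_mono) (auto simp: subseq_singleton_left B'_def C_def)
      then have "x < y \<longrightarrow> i \<le> y" using av that unfolding split av_iff_subseq by (auto simp: B'_def)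
      moreover have "x \<noteq> y" using that distPQ by (auto simp: B'_def C_def)
      ultimately show ?thesis using that by (auto simp: C_def)
    qed
    have "distinct B'" using distPQ by (simp add: B'_def)
    then have cardB': "card (set B') = k" by (simp add: k_def distinct_card)
    have "i - k = a" using ak by simp
    then have B': "set B' = {a..<a + k}" and C: "C = {..<a}"
      using upper_part_of_lessThan[OF un below] by (simp_all only: cardB' ak)
    have L'_big: "a + k < x" if "x \<in> set L'" for x
      using that no_i(1) ak by (auto simp: L'_def) (metis linorder_neqE_nat)
    have Q_vals: "x < a \<or> a + k < x" if "x \<in> set Q" for x
      using that no_i(2) C ak by (metis (mono_tags, lifting) C_def lessThan_iff linorder_neqE_nat mem_Collect_eq)
    \<comment> \<open>Inverse of \<open>make_room k a\<close> on values outside the gap from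
      \<open>a\<close> to \<open>a + k\<close>.\<close>
    define un where "un v = (if v < a then v else v - Suc k)" for v
    define L R B \<tau> where "L = map un L'" and "R = map un Q" and "B = map (\<lambda>x. x - a) B'"
      and "\<tau> = L @ R"
    have mr_un: "make_room k a (un v) = v" if "v < a \<or> a + k < v" for v
      using that by (auto simp: un_def make_room_def)
    have mL: "map (make_room k a) L = L'" and mR: "map (make_room k a) R = Q"
      unfolding L_def R_def map_map using L'_big Q_vals by (auto intro!: map_idI simp: mr_un)
    have mB: "map ((+) a) B = B'"
      unfolding B_def map_map using B' by (auto intro!: map_idI)
    have \<pi>_eq: "\<pi> = insert_block k a L B R"
      unfolding insert_block_def mL mR mB by (simp add: split P ak)
    have "a \<le> un y" if "y \<in> set L'" for y
      using L'_big[OF that] by (simp add: un_def)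
    then have L_big: "\<forall>x\<in>set L. a \<le> x" by (simp add: L_def)
    have setB: "set B = {..<k}"
    proof -
      have "(\<lambda>x. x - a) ` {a..<a + k} = {..<k}"
        by (auto simp: image_iff intro!: bexI[of _ "_ + a"])
      then show ?thesis by (simp add: B_def B')
    qed
    have avs: "av (<) (L @ R)" "av (<) B" "sorted (filter ((\<le>) a) R)"
      using av av_insert_block[OF L_big, of B k R] setB unfolding \<pi>_eq by auto
    have kn: "k < n" using ak i(1) by simp
    have dist\<tau>: "distinct \<tau>"
    proof -
      have "distinct (map (make_room k a) \<tau>)"
        using distPQ unfolding \<tau>_def map_append mL mR P by auto
      then show ?thesis by (simp add: distinct_map)
    qed
    have lenQ: "length Q = n - Suc i" by (simp add: Q_def len)
    have len\<tau>: "length \<tau> = n - Suc k"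
      using lenQ ak i(1) by (simp add: \<tau>_def L_def R_def a_def[symmetric])
    have am: "a \<le> n - Suc k"
      unfolding len\<tau>[symmetric] by (simp add: \<tau>_def L_def a_def)
    have set\<tau>: "set \<tau> = {..<n - Suc k}"
    proof (rule card_subset_eq)
      show "set \<tau> \<subseteq> {..<n - Suc k}"
      proof
        fix x assume "x \<in> set \<tau>"
        then obtain y where y: "x = un y" "y \<in> set L' \<union> set Q" by (auto simp: \<tau>_def L_def R_def)
        then have "y < n" "y < a \<or> a + k < y" using set Q_vals L'_big P split by auto
        with y(1) am show "x \<in> {..<n - Suc k}" by (auto simp: un_def)
      qed
      show "card (set \<tau>) = card {..<n - Suc k}"
        using dist\<tau> len\<tau> by (simp add: distinct_card)
    qed simp
    have \<tau>: "\<tau> \<in> av_perms (<) (n - Suc k)"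
      using set\<tau> dist\<tau> avs(1) by (simp add: av_perms_iff \<tau>_def)
    have lenL: "length L = a" by (simp add: L_def a_def)
    have "splits_at \<tau> a"
      using L_big avs(3) by (simp add: splits_at_def \<tau>_def lenL[symmetric])
    then have pos: "splitting_pos \<tau> = a" by (rule splitting_pos_eq[OF \<tau>])
    have "distinct B" using \<open>distinct B'\<close> unfolding mB[symmetric] by (simp add: distinct_map)
    moreover have "B ! j \<noteq> j" if "j < k" for j
    proof
      assume "B ! j = j"
      moreover have "length B = k" by (simp add: B_def k_def)
      ultimately have "\<pi> ! (a + j) = a + j"
        using nth_insert_block(2)[OF lenL _ that] by (simp add: \<pi>_eq)
      moreover have "a + j < i" using that ak by simp
      ultimately show False using i_min by blast
    qed
    ultimately have "B \<in> av_ders (<) k"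
      using setB avs(2) by (simp add: av_ders_def av_perms_iff)
    with \<tau> kn have in_A: "(k, B, \<tau>) \<in> ?A" by simp
    have "take a \<tau> = L" "drop a \<tau> = R" by (simp_all add: \<tau>_def lenL[symmetric])
    then have "\<pi> = ?F (k, B, \<tau>)" by (simp add: pos \<pi>_eq)
    then show "\<pi> \<in> ?F ` ?A" using in_A by (rule image_eqI)
  qed
qed

lemma sum_av_perms_lt_fixed_point:
  "(\<Sum>\<sigma>\<in>av_perms (<) n. g (inc_suffix \<sigma>)) =
   (\<Sum>\<sigma>\<in>av_ders (<) n. g (inc_suffix \<sigma>)) +
   (\<Sum>k<n. \<Sum>\<beta>\<in>av_ders (<) k. \<Sum>\<tau>\<in>av_perms (<) (n - Suc k).
      g (if sorted \<tau> then Suc (inc_suffix \<beta> + (n - Suc k)) else inc_suffix \<tau>) :: 'a :: comm_monoid_add)"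
proof -
  have "(\<Sum>\<sigma>\<in>av_perms (<) n. g (inc_suffix \<sigma>)) =
     (\<Sum>\<sigma>\<in>av_perms (<) n - av_ders (<) n. g (inc_suffix \<sigma>)) + (\<Sum>\<sigma>\<in>av_ders (<) n. g (inc_suffix \<sigma>))"
    by (rule sum.subset_diff) (auto simp: av_ders_def)
  also have "(\<Sum>\<sigma>\<in>av_perms (<) n - av_ders (<) n. g (inc_suffix \<sigma>)) =
     (\<Sum>(k, \<beta>, \<tau>)\<in>(SIGMA k:{..<n}. av_ders (<) k \<times> av_perms (<) (n - Suc k)).
       g (if sorted \<tau> then Suc (inc_suffix \<beta> + (n - Suc k)) else inc_suffix \<tau>))"
  proof -
    have "inc_suffix (insert_block k (splitting_pos \<tau>) (take (splitting_pos \<tau>) \<tau>) \<beta> (drop (splitting_pos \<tau>) \<tau>)) =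
        (if sorted \<tau> then Suc (inc_suffix \<beta> + (n - Suc k)) else inc_suffix \<tau>)"
      if "\<beta> \<in> av_ders (<) k" "\<tau> \<in> av_perms (<) (n - Suc k)" for k \<beta> \<tau>
      by (rule inc_suffix_insert_block[OF that(2) refl]) (use that(1) in \<open>simp add: av_ders_def av_perms_iff\<close>)
    then show ?thesis
      unfolding sum.reindex_bij_betw[OF bij_betw_lt_fixed_point, symmetric]
      by (intro sum.cong refl) auto
  qed
  also have "\<dots> = (\<Sum>k<n. \<Sum>\<beta>\<in>av_ders (<) k. \<Sum>\<tau>\<in>av_perms (<) (n - Suc k).
      g (if sorted \<tau> then Suc (inc_suffix \<beta> + (n - Suc k)) else inc_suffix \<tau>))"
    by (simp add: sum.Sigma sum.cartesian_product)
  finally show ?thesis by (simp add: add.commute)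
qed

section \<open>Words as shuffles of derangements\<close>

lemma in_shuffles_replicate_iff:
  assumes "z \<notin> set xs"
  shows "w \<in> shuffles xs (replicate k z) \<longleftrightarrow> filter (\<lambda>x. x \<noteq> z) w = xs \<and> length w = length xs + k"
proof
  assume w: "w \<in> shuffles xs (replicate k z)"
  then have "filter (\<lambda>x. x \<noteq> z) w \<in> filter (\<lambda>x. x \<noteq> z) ` shuffles xs (replicate k z)" by blast
  also have "\<dots> = {xs}"
    unfolding filter_shuffles using assms by (auto simp: filter_id_conv)
  finally show "filter (\<lambda>x. x \<noteq> z) w = xs \<and> length w = length xs + k"
    using length_shuffles[OF w] by simp
next
  assume *: "filter (\<lambda>x. x \<noteq> z) w = xs \<and> length w = length xs + k"
  then have "length (filter (\<lambda>x. \<not> x \<noteq> z) w) = k"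
    using sum_length_filter_compl[of "\<lambda>x. x \<noteq> z" w] by simp
  then have "filter (\<lambda>x. \<not> x \<noteq> z) w = replicate k z"
    by (intro replicate_eqI) auto
  with * show "w \<in> shuffles xs (replicate k z)"
    using partition_in_shuffles[of w "\<lambda>x. x \<noteq> z"] by simp
qed

text \<open>Induction by the first letter. A leading letter of \<open>d\<close> does not see the
  copies of \<open>z\<close>, so it only repeats a condition on \<open>d\<close>; a leading
  \<open>z\<close> sees exactly the letters of \<open>d\<close>, so \<open>d\<close> must be sorted.
  For sorted \<open>d\<close> the two cases add up by Pascal's rule; otherwise \<open>z\<close>
  cannot lead and the suffix is that of the tail.\<close>

lemma card_av_shuffles:
  assumes "\<forall>x\<in>set d. r z x \<and> \<not> r x z" "\<not> r z z" "av r d"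
  shows "card {w \<in> shuffles d (replicate k z). av r w} = (inc_suffix d + k) choose k"
  using assms(1,3)
proof (induction k arbitrary: d)
  case 0
  then have "{w \<in> shuffles d (replicate 0 z). av r w} = {d}" by auto
  then show ?case by simp
next
  case (Suc k)
  note IH_k = Suc.IH
  show ?case
    using Suc.prems
  proof (induction d)
    case Nil
    have "av r (replicate j z)" for j
      using assms(2) by (induction j) (auto simp: filter_empty_conv)
    then have "{w \<in> shuffles [] (replicate (Suc k) z). av r w} = {replicate (Suc k) z}"
      by (auto simp del: replicate_Suc av.simps)
    then show ?case by simp
  next
    case (Cons x d)
    let ?W = "\<lambda>d k. {w \<in> shuffles d (replicate k z). av r w}"
    have x: "r z x" "\<not> r x z" "x \<noteq> z" using Cons.prems(1) by auto
    have z_notin: "z \<notin> set (x # d)" using Cons.prems(1) assms(2) by auto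
    have fx: "av r (x # w) \<longleftrightarrow> av r w" if w: "w \<in> shuffles d (replicate (Suc k) z)" for w
    proof -
      have d: "filter (\<lambda>y. y \<noteq> z) w = d"
        using w z_notin by (simp add: in_shuffles_replicate_iff del: replicate_Suc)
      have "filter (r x) w = filter (r x) (filter (\<lambda>y. y \<noteq> z) w)"
        unfolding filter_filter using x by (intro filter_cong) auto
      then show ?thesis using Cons.prems(2) d by simp
    qed
    have fz: "av r (z # w) \<longleftrightarrow> sorted (x # d) \<and> av r w" if w: "w \<in> shuffles (x # d) (replicate k z)" for w
    proof -
      have d: "filter (\<lambda>y. y \<noteq> z) w = x # d"
        using w z_notin by (simp add: in_shuffles_replicate_iff)
      have "set w \<subseteq> insert z (set (x # d))" using set_shuffles[OF w] by (auto simp: set_replicate_conv_if split: if_splits)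
      then have "filter (r z) w = filter (\<lambda>y. y \<noteq> z) w"
        using Cons.prems(1) assms(2) by (intro filter_cong) auto
      then show ?thesis using d by simp
    qed
    have "?W (x # d) (Suc k) = (#) x ` ?W d (Suc k) \<union> (#) z ` (if sorted (x # d) then ?W (x # d) k else {})"
      using fx fz by (auto simp del: av.simps)
    moreover have "card ((#) x ` ?W d (Suc k)) = card (?W d (Suc k))"
      by (intro card_image) auto
    moreover have "card (?W d (Suc k)) = (inc_suffix d + Suc k) choose Suc k"
      using Cons by simp
    moreover have "card ((#) z ` (if sorted (x # d) then ?W (x # d) k else {})) =
        (if sorted (x # d) then (inc_suffix (x # d) + k) choose k else 0)"
      using IH_k[OF Cons.prems] by (simp add: card_image)
    moreover have "(#) x ` ?W d (Suc k) \<inter> (#) z ` (if sorted (x # d) then ?W (x # d) k else {}) = {}"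
      using x by auto
    ultimately have "card (?W (x # d) (Suc k)) = (inc_suffix d + Suc k choose Suc k) +
        (if sorted (x # d) then (inc_suffix (x # d) + k) choose k else 0)"
      by (simp add: card_Un_disjoint)
    then show ?case
      by (cases "sorted (x # d)") (auto simp: inc_suffix_sorted)
  qed
qed

section \<open>Derangement forms in terms of ranks\<close>

definition ders :: "nat \<Rightarrow> nat list set" where
  "ders m = {d \<in> permutations_of_set {..<m}. \<forall>i<m. d ! i \<noteq> i}"

lemma ders_iff: "d \<in> ders m \<longleftrightarrow> distinct d \<and> set d = {..<m} \<and> (\<forall>i<m. d ! i \<noteq> i)"
  by (auto simp: ders_def permutations_of_set_def)

lemma av_ders_eq: "av_ders r m = {d \<in> ders m. av r d}"
  by (auto simp: ders_iff av_ders_def av_perms_iff)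

lemma length_ders: "d \<in> ders m \<Longrightarrow> length d = m"
  by (metis card_lessThan distinct_card ders_iff)

lemma finite_ders [simp]: "finite (ders m)"
  by (simp add: ders_def)

text \<open>Positions count from 0 while the values of \<open>p\<close> count from 1, hence the
  comparison with \<open>Suc i\<close>.\<close>

definition nonfixed :: "nat list \<Rightarrow> nat list" where
  "nonfixed p = filter (\<lambda>i. p ! i \<noteq> Suc i) [0..<length p]"

definition index_in :: "nat list \<Rightarrow> nat \<Rightarrow> nat" where
  "index_in xs x = card {y \<in> set xs. y < x}"

lemma index_in_nth:
  assumes "sorted_wrt (<) xs" "t < length xs"
  shows "index_in xs (xs ! t) = t"
proof -
  have srt: "sorted xs" "distinct xs"
    using assms(1) strict_sorted_iff by blast+
  have "{y \<in> set xs. y < xs ! t} = (!) xs ` {..<t}"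
  proof (intro equalityI subsetI)
    fix y assume "y \<in> {y \<in> set xs. y < xs ! t}"
    then obtain s where s: "s < length xs" "y = xs ! s" "xs ! s < xs ! t" by (auto simp: in_set_conv_nth)
    then have "s < t"
      using sorted_nth_mono[OF srt(1), of t s] by (metis leD not_le)
    with s show "y \<in> (!) xs ` {..<t}" by blast
  qed (use assms in \<open>auto simp: sorted_wrt_iff_nth_less\<close>)
  moreover have "inj_on ((!) xs) {..<t}"
    using srt(2) assms(2) by (intro inj_on_nth) auto
  ultimately show ?thesis by (simp add: index_in_def card_image)
qed

text \<open>\<open>p\<close> is injective and sends the fixed positions onto their successors, so
  the complementary positions are sent onto theirs.\<close>

lemma nth_image_nonfixed:
  assumes p: "p \<in> permutations_of_set {1..n}"
  shows "(!) p ` set (nonfixed p) = Suc ` set (nonfixed p)"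
proof -
  have len: "length p = n" and dist: "distinct p" and set: "set p = {1..n}"
    using p distinct_card[of p] by (auto simp: permutations_of_set_def)
  let ?N = "set (nonfixed p)"
  have N: "?N \<subseteq> {..<n}" by (auto simp: nonfixed_def len)
  have inj: "inj_on ((!) p) {..<n}" using dist len by (intro inj_on_nth) auto
  have img: "(!) p ` {..<n} = Suc ` {..<n}"
    using nth_image[of n p] set len by (simp add: lessThan_atLeast0 image_Suc_atLeastLessThan atLeastLessThanSuc_atLeastAtMost)
  have fixed: "(!) p ` ({..<n} - ?N) = Suc ` ({..<n} - ?N)"
    by (intro image_cong) (auto simp: nonfixed_def len)
  have "(!) p ` ?N = (!) p ` {..<n} - (!) p ` ({..<n} - ?N)"
    using inj_on_image_set_diff[OF inj, of "{..<n}" "{..<n} - ?N"] N by (simp add: double_diff)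
  also have "\<dots> = Suc ` ?N"
    unfolding img fixed using N by auto
  finally show ?thesis .
qed

text \<open>The positive letters are the successors of the nonfixed positions. Counting letters up
  to and including a given one exceeds the strict count in \<open>index_in\<close> by one.\<close>

lemma der_form_eq:
  assumes p: "p \<in> permutations_of_set {1..n}"
  shows "der_form p = map (\<lambda>i. if p ! i = Suc i then -1 else int (index_in (nonfixed p) (p ! i - 1)) + 1) [0..<n]"
proof -
  have len: "length p = n" and set: "set p = {1..n}"
    using p distinct_card[of p] by (auto simp: permutations_of_set_def)
  define v where "v = map (\<lambda>i. if p ! i = i + 1 then -1 else int (p ! i)) [0..<length p]"
  have pos: "0 < p ! i" if "i < n" for i using set len that nth_mem by fastforce
  have "{y \<in> set v. 0 < y} = int ` (!) p ` set (nonfixed p)"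
    using pos by (auto simp: v_def nonfixed_def len image_iff)
  also have "\<dots> = int ` Suc ` set (nonfixed p)" by (simp only: nth_image_nonfixed[OF p])
  finally have v: "{y \<in> set v. 0 < y} = int ` Suc ` set (nonfixed p)" .
  have card_int_Suc: "card (int ` Suc ` X) = card X" for X
    unfolding image_image by (rule card_image) (simp add: inj_on_def)
  have rank: "int (card {y \<in> set v. 0 < y \<and> y \<le> int (p ! i)}) = int (index_in (nonfixed p) (p ! i - 1)) + 1"
    if i: "i < n" "p ! i \<noteq> Suc i" for i
  proof -
    have "p ! i \<in> Suc ` set (nonfixed p)"
      using i nth_image_nonfixed[OF p] by (auto simp: nonfixed_def len)
    then obtain j where j: "p ! i = Suc j" "j \<in> set (nonfixed p)" by auto
    have "{y \<in> set v. 0 < y \<and> y \<le> int (p ! i)} = {y \<in> {y \<in> set v. 0 < y}. y \<le> int (p ! i)}" by auto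
    also have "\<dots> = int ` Suc ` insert j {y \<in> set (nonfixed p). y < j}"
      unfolding v using j by (auto simp: image_iff)
    finally have "card {y \<in> set v. 0 < y \<and> y \<le> int (p ! i)} = card (insert j {y \<in> set (nonfixed p). y < j})"
      by (simp only: card_int_Suc)
    then show ?thesis
      using j by (simp add: index_in_def)
  qed
  have "der_form p = std_pos v" by (simp add: der_form_def v_def)
  also have "\<dots> = map (\<lambda>i. if p ! i = Suc i then -1 else int (index_in (nonfixed p) (p ! i - 1)) + 1) [0..<n]"
    unfolding std_pos_def
  proof (rule nth_equalityI)
    fix i assume "i < length (map (\<lambda>x. if x = -1 then -1 else int (card {y \<in> set v. 0 < y \<and> y \<le> x})) v)"
    then have i: "i < n" by (simp add: v_def len)
    have "v ! i = (if p ! i = Suc i then -1 else int (p ! i))" using i len by (simp add: v_def)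
    then show "map (\<lambda>x. if x = -1 then -1 else int (card {y \<in> set v. 0 < y \<and> y \<le> x})) v ! i =
        map (\<lambda>i. if p ! i = Suc i then -1 else int (index_in (nonfixed p) (p ! i - 1)) + 1) [0..<n] ! i"
      using i rank[OF i] by (simp add: v_def len)
  qed (simp add: v_def len)
  finally show ?thesis .
qed

lemma strict_sorted_filter_upt: "sorted_wrt (<) (filter P [0..<n])"
  by (simp add: sorted_wrt_filter)

lemma index_in_image:
  assumes "sorted_wrt (<) xs"
  shows "index_in xs ` set xs = {..<length xs}" "inj_on (index_in xs) (set xs)"
proof -
  show "index_in xs ` set xs = {..<length xs}"
    using index_in_nth[OF assms] by (force simp: set_conv_nth image_iff)
  show "inj_on (index_in xs) (set xs)"
    using index_in_nth[OF assms] by (metis in_set_conv_nth inj_onI)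
qed

text \<open>Relabelling the nonfixed positions and their values by the same ranks gives a
  derangement. Conversely, a derangement spread over the positions that do not carry
  \<open>-1\<close>, with every other position fixed, has the given word as its form.\<close>

lemma D1_eq:
  "D1 n = (\<Union>m\<le>n. \<Union>d\<in>ders m. shuffles (map (\<lambda>x. int x + 1) d) (replicate (n - m) (-1)))"
proof (intro equalityI subsetI)
  fix w assume "w \<in> D1 n"
  then obtain p where p: "p \<in> permutations_of_set {1..n}" and w: "w = der_form p"
    by (auto simp: D1_def)
  have len: "length p = n" using p distinct_card[of p] by (auto simp: permutations_of_set_def)
  let ?idx = "nonfixed p"
  define m where "m = length ?idx"
  have mn: "m \<le> n" unfolding m_def nonfixed_def using length_filter_le[of _ "[0..<length p]"] len by simp
  have ss: "sorted_wrt (<) ?idx" unfolding nonfixed_def by (rule strict_sorted_filter_upt)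
  define d where "d = map (\<lambda>i. index_in ?idx (p ! i - 1)) ?idx"
  have "set d = index_in ?idx ` (\<lambda>x. x - 1) ` (!) p ` set ?idx"
    by (simp add: d_def image_image)
  also have "\<dots> = index_in ?idx ` set ?idx"
    unfolding nth_image_nonfixed[OF p] by (simp add: image_image)
  finally have set_d: "set d = {..<m}" by (simp add: index_in_image[OF ss] m_def)
  have "length d = m" by (simp add: d_def m_def)
  with set_d have "distinct d" by (simp add: card_distinct)
  \<comment> \<open>Ranks are injective on \<open>?idx\<close>, so a fixed point of \<open>d\<close>
    would come from a nonfixed position that \<open>p\<close> fixes.\<close>
  have "d ! s \<noteq> s" if s: "s < m" for s
  proof
    assume "d ! s = s"
    then have eq: "index_in ?idx (p ! (?idx ! s) - 1) = index_in ?idx (?idx ! s)"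
      using s index_in_nth[OF ss] by (simp add: d_def m_def)
    have in_idx: "?idx ! s \<in> set ?idx" using s by (simp add: m_def)
    then have "p ! (?idx ! s) \<in> Suc ` set ?idx" using nth_image_nonfixed[OF p] by blast
    then obtain j where j: "p ! (?idx ! s) = Suc j" "j \<in> set ?idx" by auto
    with eq in_idx have "j = ?idx ! s"
      using index_in_image(2)[OF ss] by (auto dest: inj_onD)
    with j in_idx show False by (simp add: nonfixed_def)
  qed
  with set_d \<open>distinct d\<close> have d: "d \<in> ders m" by (simp add: ders_iff)
  have "filter (\<lambda>x. x \<noteq> -1) w = map (\<lambda>x. int x + 1) d"
  proof -
    have "filter (\<lambda>x. x \<noteq> -1) w = map (\<lambda>i. if p ! i = Suc i then -1 else int (index_in ?idx (p ! i - 1)) + 1)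
        (filter (\<lambda>i. p ! i \<noteq> Suc i) [0..<n])"
      unfolding w der_form_eq[OF p] filter_map
      by (intro arg_cong[where f = "map _"] filter_cong refl) auto
    also have "\<dots> = map (\<lambda>x. int x + 1) d"
      by (auto simp: d_def nonfixed_def len)
    finally show ?thesis .
  qed
  moreover have "length w = n" by (simp add: w der_form_eq[OF p])
  ultimately have "w \<in> shuffles (map (\<lambda>x. int x + 1) d) (replicate (n - m) (-1))"
    using mn \<open>length d = m\<close> by (subst in_shuffles_replicate_iff) auto
  with d mn show "w \<in> (\<Union>m\<le>n. \<Union>d\<in>ders m. shuffles (map (\<lambda>x. int x + 1) d) (replicate (n - m) (-1)))"
    by blast
next
  fix w assume "w \<in> (\<Union>m\<le>n. \<Union>d\<in>ders m. shuffles (map (\<lambda>x. int x + 1) d) (replicate (n - m) (-1)))"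
  then obtain m d where m: "m \<le> n" and d: "d \<in> ders m"
    and "w \<in> shuffles (map (\<lambda>x. int x + 1) d) (replicate (n - m) (-1))" by blast
  then have filt: "filter (\<lambda>x. x \<noteq> -1) w = map (\<lambda>x. int x + 1) d" and len_w: "length w = n"
    using length_ders[OF d] by (subst (asm) in_shuffles_replicate_iff; auto)+
  define idx where "idx = filter (\<lambda>i. w ! i \<noteq> -1) [0..<n]"
  have ss: "sorted_wrt (<) idx" unfolding idx_def by (rule strict_sorted_filter_upt)
  have "filter (\<lambda>x. x \<noteq> -1) (map ((!) w) [0..<n]) = map ((!) w) idx"
    unfolding filter_map idx_def by (simp add: o_def)
  then have w_idx: "map ((!) w) idx = map (\<lambda>x. int x + 1) d"
    using filt len_w map_nth[of w] by simp
  then have len_idx: "length idx = m" using length_ders[OF d] by (metis length_map)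
  have w_nth: "w ! (idx ! s) = int (d ! s) + 1" if "s < m" for s
    using that arg_cong[OF w_idx, of "\<lambda>l. l ! s"] len_idx length_ders[OF d] by simp
  have d_less: "d ! s < m" if "s < m" for s
    using that d length_ders[OF d] nth_mem[of s d] by (auto simp: ders_iff)
  \<comment> \<open>A letter other than \<open>-1\<close> is one more than an entry of
    \<open>d\<close>; subtracting one gives the rank in \<open>idx\<close> of the target
    position.\<close>
  define p where "p = map (\<lambda>i. if w ! i = -1 then Suc i else Suc (idx ! nat (w ! i - 1))) [0..<n]"
  have len_p: "length p = n" by (simp add: p_def)
  have p_fixed: "p ! i = Suc i" if "i < n" "w ! i = -1" for i using that by (simp add: p_def)
  have in_idx: "\<exists>s<m. i = idx ! s" if "i < n" "w ! i \<noteq> -1" for i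
  proof -
    from that have "i \<in> set idx" by (simp add: idx_def)
    then show ?thesis by (metis in_set_conv_nth len_idx)
  qed
  have idx_less: "idx ! s < n" if "s < m" for s
    using that len_idx nth_mem[of s idx] by (auto simp: idx_def)
  have p_idx: "p ! (idx ! s) = Suc (idx ! (d ! s))" if "s < m" for s
    using w_nth[OF that] idx_less[OF that] by (simp add: p_def)
  have "{1..n} \<subseteq> set p"
  proof
    fix x assume "x \<in> {1..n}"
    then obtain j where j: "x = Suc j" "j < n" by (cases x) auto
    show "x \<in> set p"
    proof (cases "w ! j = -1")
      case True
      then show ?thesis using p_fixed[OF j(2)] j len_p by (metis nth_mem)
    next
      case False
      then obtain t where t: "t < m" "j = idx ! t" using in_idx j(2) by blast
      then have "t \<in> set d" using d by (simp add: ders_iff)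
      then obtain s where "s < m" "t = d ! s" using length_ders[OF d] by (metis in_set_conv_nth)
      then have "p ! (idx ! s) = x" "idx ! s < length p" using p_idx t j idx_less len_p by auto
      then show ?thesis by (metis nth_mem)
    qed
  qed
  moreover have "card (set p) \<le> card {1..n}" using card_length[of p] len_p by simp
  ultimately have set_p: "set p = {1..n}" by (metis card_seteq finite_set)
  then have "distinct p" using len_p by (simp add: card_distinct)
  with set_p have p: "p \<in> permutations_of_set {1..n}" by (simp add: permutations_of_set_def)
  have nonfixed: "p ! i \<noteq> Suc i" if i: "i < n" "w ! i \<noteq> -1" for i
  proof -
    obtain s where s: "s < m" "i = idx ! s" using in_idx[OF i] by blast
    have "d ! s \<noteq> s" using d s by (simp add: ders_iff)
    then have "idx ! (d ! s) \<noteq> idx ! s"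
      using s d_less[OF s(1)] len_idx strict_sorted_iff[of idx] ss by (simp add: nth_eq_iff_index_eq)
    then show ?thesis using p_idx s by simp
  qed
  have "nonfixed p = idx"
    unfolding nonfixed_def idx_def len_p using p_fixed nonfixed by (intro filter_cong) auto
  then have "der_form p = map (\<lambda>i. if p ! i = Suc i then -1 else int (index_in idx (p ! i - 1)) + 1) [0..<n]"
    using der_form_eq[OF p] by simp
  also have "\<dots> = w"
  proof (rule nth_equalityI)
    fix i assume "i < length (map (\<lambda>i. if p ! i = Suc i then -1 else int (index_in idx (p ! i - 1)) + 1) [0..<n])"
    then have i: "i < n" by simp
    show "map (\<lambda>i. if p ! i = Suc i then -1 else int (index_in idx (p ! i - 1)) + 1) [0..<n] ! i = w ! i"
    proof (cases "w ! i = -1")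
      case True
      then show ?thesis using i p_fixed by simp
    next
      case False
      then obtain s where s: "s < m" "i = idx ! s" using in_idx i by blast
      then have "index_in idx (p ! i - 1) = d ! s"
        using p_idx[OF s(1)] index_in_nth[OF ss, of "d ! s"] d_less[OF s(1)] len_idx by simp
      then show ?thesis using i nonfixed[OF i False] w_nth[OF s(1)] s by simp
    qed
  qed (simp add: len_w)
  finally show "w \<in> D1 n" using p by (auto simp: D1_def)
qed

section \<open>Counting the words that avoid a pattern\<close>

lemma av_filter: "av r w \<Longrightarrow> av r (filter P w)"
  by (auto simp: av_iff_subseq subseq_filter_iff)

lemma minus_one_notin: "-1 \<notin> set (map (\<lambda>x. int x + 1) d)"
  by auto

text \<open>Deleting the letters \<open>-1\<close> recovers \<open>d\<close>, and its length
  recovers \<open>m\<close>, so the shuffle sets are disjoint.\<close>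

lemma card_av_D1:
  "card {w \<in> D1 n. av r w} = (\<Sum>m\<le>n. \<Sum>d\<in>ders m.
     card {w \<in> shuffles (map (\<lambda>x. int x + 1) d) (replicate (n - m) (-1)). av r w})"
proof -
  let ?W = "\<lambda>(m, d). {w \<in> shuffles (map (\<lambda>x. int x + 1) d) (replicate (n - m) (-1)). av r w}"
  have filt: "filter (\<lambda>x. x \<noteq> -1) w = map (\<lambda>x. int x + 1) d" if "w \<in> ?W (m, d)" for w m d
    using that by (auto simp: in_shuffles_replicate_iff[OF minus_one_notin])
  have "{w \<in> D1 n. av r w} = (\<Union>p\<in>(SIGMA m:{..n}. ders m). ?W p)"
    unfolding D1_eq by auto
  also have "card \<dots> = (\<Sum>p\<in>(SIGMA m:{..n}. ders m). card (?W p))"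
  proof (rule card_UN_disjoint)
    show "\<forall>p\<in>(SIGMA m:{..n}. ders m). \<forall>p'\<in>(SIGMA m:{..n}. ders m). p \<noteq> p' \<longrightarrow> ?W p \<inter> ?W p' = {}"
    proof (intro ballI impI, rule ccontr)
      fix p p' assume *: "p \<in> (SIGMA m:{..n}. ders m)" "p' \<in> (SIGMA m:{..n}. ders m)"
        and "p \<noteq> p'" "?W p \<inter> ?W p' \<noteq> {}"
      then obtain w m d m' d' where w: "p = (m, d)" "p' = (m', d')" "w \<in> ?W (m, d)" "w \<in> ?W (m', d')"
        by (cases p; cases p') blast
      have "map (\<lambda>x. int x + 1) d = map (\<lambda>x. int x + 1) d'"
        using filt[OF w(3)] filt[OF w(4)] by simp
      then have "d = d'" by (rule map_injective) (simp add: inj_def)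
      moreover have "m = m'" using * w(1,2) \<open>d = d'\<close> length_ders by auto
      ultimately show False using w \<open>p \<noteq> p'\<close> by simp
    qed
  qed auto
  finally show ?thesis by (simp add: sum.Sigma split_def)
qed

lemma card_D1_av_132:
  "card (D1_av n [1, 3, 2]) = (\<Sum>m\<le>n. \<Sum>d\<in>av_ders (<) m. (inc_suffix d + (n - m)) choose (n - m))"
proof -
  have "card {w \<in> shuffles (map (\<lambda>x. int x + 1) d) (replicate k (-1)). av (<) w} =
      (if av (<) d then (inc_suffix d + k) choose k else 0)" for d and k :: nat
  proof -
    have av_d: "av (<) (map (\<lambda>x. int x + 1) d) \<longleftrightarrow> av (<) d" by (rule av_map) auto
    have suf: "inc_suffix (map (\<lambda>x. int x + 1) d) = inc_suffix d" by (rule inc_suffix_map) auto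
    show ?thesis
    proof (cases "av (<) d")
      case True
      then show ?thesis
        using card_av_shuffles[of "map (\<lambda>x. int x + 1) d" "(<)" "-1" k] av_d suf by simp
    next
      case False
      have "\<not> av (<) w" if "w \<in> shuffles (map (\<lambda>x. int x + 1) d) (replicate k (-1))" for w
        using that False av_d av_filter[of "(<)" w "\<lambda>x. x \<noteq> -1"] by (auto simp: in_shuffles_replicate_iff[OF minus_one_notin])
      then have empty: "{w \<in> shuffles (map (\<lambda>x. int x + 1) d) (replicate k (-1)). av (<) w} = {}" by blast
      show ?thesis unfolding empty using False by simp
    qed
  qed
  then show ?thesis
    unfolding D1_av_def avoids_132 card_av_D1 by (simp add: av_ders_eq sum.If_cases Int_def)
qed

definition rev_compl :: "nat \<Rightarrow> nat list \<Rightarrow> nat list" where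
  "rev_compl m d = rev (map (\<lambda>x. m - 1 - x) d)"

text \<open>The map conjugates by the reversal of \<open>{..<m}\<close>, so it is an involution,
  carries fixed points to fixed points and keeps the pattern 321.\<close>

lemma rev_compl_av_ders:
  assumes d: "d \<in> av_ders (>) m"
  shows "rev_compl m d \<in> av_ders (>) m" "rev_compl m (rev_compl m d) = d"
proof -
  have len: "length d = m" and set: "set d = {..<m}" and dist: "distinct d" and av: "av (>) d"
    and nofix: "\<And>i. i < m \<Longrightarrow> d ! i \<noteq> i"
    using d by (auto simp: av_ders_def length_av_perms) (auto simp: av_perms_iff)
  have inv: "map (\<lambda>x. m - 1 - (m - 1 - x)) d = d" using set by (intro map_idI) auto
  then show "rev_compl m (rev_compl m d) = d" by (simp add: rev_compl_def rev_map o_def)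
  have "x \<in> (\<lambda>x. m - 1 - x) ` {..<m}" if "x < m" for x
    using that by (intro image_eqI[where x = "m - 1 - x"]) auto
  then have "set (rev_compl m d) = {..<m}"
    unfolding rev_compl_def set_rev set_map set by auto
  moreover have "inj_on (\<lambda>x. m - 1 - x) {..<m}"
    by (rule inj_on_inverseI[where g = "\<lambda>x. m - 1 - x"]) auto
  then have "distinct (rev_compl m d)"
    using dist set by (simp only: rev_compl_def distinct_rev distinct_map simp_thms)
  moreover have "av (>) (rev_compl m d)"
    unfolding rev_compl_def
  proof (subst av_gt_rev_map)
    fix x y assume "x \<in> set d" "y \<in> set d"
    then have "x < m" "y < m" unfolding set by simp_all
    then show "m - 1 - x \<le> m - 1 - y \<longleftrightarrow> y \<le> x" by linarith
  qed (rule av)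
  moreover have "rev_compl m d ! i \<noteq> i" if i: "i < m" for i
  proof
    assume "rev_compl m d ! i = i"
    then have "m - 1 - d ! (m - 1 - i) = i" using i len by (simp add: rev_compl_def rev_nth)
    moreover have "d ! (m - 1 - i) < m" using i len set nth_mem[of "m - 1 - i" d] by auto
    ultimately have "d ! (m - 1 - i) = m - 1 - i" by linarith
    with nofix[of "m - 1 - i"] i show False by simp
  qed
  ultimately show "rev_compl m d \<in> av_ders (>) m" by (simp add: av_ders_def av_perms_iff)
qed

text \<open>For \<open>(>)\<close> the extreme letter must be the largest, while \<open>-1\<close>
  is the smallest. Reversing and negating keeps 321 and turns \<open>-1\<close> into
  \<open>1\<close>, above all other letters. The binomial then involves the suffix of the
  reverse-complement, which the involution removes from the sum.\<close>

lemma card_D1_av_321: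
  "card (D1_av n [3, 2, 1]) = (\<Sum>m\<le>n. \<Sum>d\<in>av_ders (>) m. (inc_suffix d + (n - m)) choose (n - m))"
proof -
  have "card {w \<in> shuffles (map (\<lambda>x. int x + 1) d) (replicate k (-1)). av (>) w} =
      (if av (>) d then (inc_suffix (rev_compl m d) + k) choose k else 0)"
    if d: "d \<in> ders m" for d and k m :: nat
  proof -
    let ?neg = "\<lambda>w :: int list. rev (map uminus w)"
    let ?d = "map (\<lambda>x. int x + 1) d"
    have neg_neg: "?neg (?neg w) = w" for w by (simp add: rev_map o_def)
    have av_neg: "av (>) (?neg w) \<longleftrightarrow> av (>) w" for w by (rule av_gt_rev_map) auto
    have av_d: "av (>) (map (\<lambda>x. int x + 1) d) \<longleftrightarrow> av (>) d" by (rule av_map) auto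
    have sh: "?neg w \<in> shuffles (?neg ?d) (replicate k 1) \<longleftrightarrow> w \<in> shuffles ?d (replicate k (-1))" for w
    proof -
      have "filter (\<lambda>x. x \<noteq> 1) (?neg w) = ?neg (filter (\<lambda>x. x \<noteq> -1) w)"
        by (simp add: rev_filter[symmetric] filter_map o_def)
      moreover have "?neg u = ?neg v \<longleftrightarrow> u = v" for u v using neg_neg by metis
      moreover have nz: "1 \<notin> set (?neg ?d)" by auto
      ultimately show ?thesis
        unfolding in_shuffles_replicate_iff[OF nz] in_shuffles_replicate_iff[OF minus_one_notin]
        by (simp only: length_rev length_map)
    qed
    have "bij_betw ?neg {w \<in> shuffles ?d (replicate k (-1)). av (>) w}
        {w \<in> shuffles (?neg ?d) (replicate k 1). av (>) w}"
      using sh av_neg neg_neg by (intro bij_betw_byWitness[where f' = ?neg]) (auto, metis+)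
    then have card_eq: "card {w \<in> shuffles ?d (replicate k (-1)). av (>) w} =
        card {w \<in> shuffles (?neg ?d) (replicate k 1). av (>) w}"
      by (rule bij_betw_same_card)
    \<comment> \<open>A letter \<open>x + 1\<close> becomes \<open>- x - 1\<close>, which is
      \<open>(m - 1 - x) - m\<close>.\<close>
    have "?neg ?d = map (\<lambda>y. int y - int m) (rev_compl m d)"
      using d by (auto simp: rev_compl_def rev_map ders_iff)
    then have suf: "inc_suffix (?neg ?d) = inc_suffix (rev_compl m d)"
      by (simp only:) (rule inc_suffix_map, simp)
    show ?thesis
    proof (cases "av (>) d")
      case True
      then show ?thesis
        using card_av_shuffles[of "?neg ?d" "(>)" 1 k] av_d av_neg[of ?d] card_eq suf by simp
    next
      case False
      have "\<not> av (>) w" if "w \<in> shuffles ?d (replicate k (-1))" for w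
        using that False av_d av_filter[of "(>)" w "\<lambda>x. x \<noteq> -1"] by (auto simp: in_shuffles_replicate_iff[OF minus_one_notin])
      then have empty: "{w \<in> shuffles ?d (replicate k (-1)). av (>) w} = {}" by blast
      show ?thesis unfolding empty using False by simp
    qed
  qed
  then have "card (D1_av n [3, 2, 1]) =
      (\<Sum>m\<le>n. \<Sum>d\<in>av_ders (>) m. (inc_suffix (rev_compl m d) + (n - m)) choose (n - m))"
    unfolding D1_av_def avoids_321 card_av_D1 by (simp add: av_ders_eq sum.If_cases Int_def)
  moreover have "(\<Sum>d\<in>av_ders (>) m. (inc_suffix (rev_compl m d) + (n - m)) choose (n - m)) =
      (\<Sum>d\<in>av_ders (>) m. (inc_suffix d + (n - m)) choose (n - m))" for m
    by (rule sum.reindex_bij_witness[where i = "rev_compl m" and j = "rev_compl m"])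
       (auto simp: rev_compl_av_ders)
  ultimately show ?thesis by (simp only:)
qed

section \<open>Generating functions\<close>

text \<open>Identifies the outer variable of a series over series with the inner one. It is a ring
  homomorphism, so identities valid for every weight \<open>q\<close> can be used with \<open>q\<close> itself a power series in \<open>x\<close>.\<close>

definition diag :: "'a :: comm_ring_1 fps fps \<Rightarrow> 'a fps" where
  "diag G = Abs_fps (\<lambda>n. \<Sum>m\<le>n. fps_nth (fps_nth G m) (n - m))"

lemma diag_add: "diag (F + G) = diag F + diag G"
  by (simp add: fps_eq_iff diag_def sum.distrib)

lemma diag_diff: "diag (F - G) = diag F - diag G"
  by (simp add: fps_eq_iff diag_def sum_subtractf)

lemma diag_const: "diag (fps_const c) = c"
proof (rule fps_ext)
  fix n
  have "fps_nth (diag (fps_const c)) n = (\<Sum>m\<le>n. if m = 0 then fps_nth c n else 0)"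
    unfolding diag_def fps_nth_Abs_fps by (intro sum.cong refl) auto
  then show "fps_nth (diag (fps_const c)) n = fps_nth c n" by simp
qed

lemma diag_1: "diag 1 = 1"
  using diag_const[of 1] by simp

lemma diag_X: "diag fps_X = fps_X"
proof (rule fps_ext)
  fix n
  have "fps_nth (diag fps_X) n = (\<Sum>m\<le>n. if m = 1 then fps_nth (1 :: 'a fps) (n - 1) else 0)"
    unfolding diag_def fps_nth_Abs_fps by (intro sum.cong refl) auto
  then show "fps_nth (diag fps_X) n = fps_nth (fps_X :: 'a fps) n" by (cases n) (auto simp: fps_X_def)
qed

lemma diag_mult: "diag (F * G) = diag F * diag G"
proof (rule fps_ext)
  fix n
  let ?f = "\<lambda>i j. fps_nth (fps_nth F i) j" and ?g = "\<lambda>i j. fps_nth (fps_nth G i) j"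
  have "fps_nth (diag (F * G)) n = (\<Sum>m\<le>n. \<Sum>i\<le>m. \<Sum>j\<le>n - m. ?f i j * ?g (m - i) (n - m - j))"
    by (simp add: diag_def fps_mult_nth fps_sum_nth atLeast0AtMost)
  also have "\<dots> = (\<Sum>(m, i, j)\<in>(SIGMA m:{..n}. {..m} \<times> {..n - m}). ?f i j * ?g (m - i) (n - m - j))"
    by (simp add: sum.Sigma sum.cartesian_product)
  \<comment> \<open>Here \<open>t\<close> is the total degree contributed by \<open>F\<close>, while
    \<open>i\<close> and \<open>u\<close> are the outer degrees in \<open>F\<close> and
    \<open>G\<close>.\<close>
  also have "\<dots> = (\<Sum>(t, i, u)\<in>(SIGMA t:{..n}. {..t} \<times> {..n - t}). ?f i (t - i) * ?g u (n - t - u))"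
    by (rule sum.reindex_bij_witness[where j = "\<lambda>(m, i, j). (i + j, i, m - i)"
          and i = "\<lambda>(t, i, u). (i + u, i, t - i)"]) (auto simp: algebra_simps)
  also have "\<dots> = (\<Sum>t\<le>n. (\<Sum>i\<le>t. ?f i (t - i)) * (\<Sum>u\<le>n - t. ?g u (n - t - u)))"
    by (simp add: sum.Sigma[symmetric] sum.cartesian_product[symmetric] sum_product)
  also have "\<dots> = fps_nth (diag F * diag G) n"
    by (simp add: diag_def fps_mult_nth atLeast0AtMost)
  finally show "fps_nth (diag (F * G)) n = fps_nth (diag F * diag G) n" .
qed

lemmas diag_simps = diag_add diag_diff diag_mult diag_1 diag_X diag_const

section \<open>Functional equations in the weight \<open>q\<close>\<close>

definition perm_gf :: "(nat \<Rightarrow> nat \<Rightarrow> bool) \<Rightarrow> 'a :: comm_ring_1 \<Rightarrow> 'a fps" where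
  "perm_gf r q = Abs_fps (\<lambda>n. \<Sum>\<sigma>\<in>av_perms r n. q ^ inc_suffix \<sigma>)"

definition der_gf :: "(nat \<Rightarrow> nat \<Rightarrow> bool) \<Rightarrow> 'a :: comm_ring_1 \<Rightarrow> 'a fps" where
  "der_gf r q = Abs_fps (\<lambda>n. \<Sum>\<sigma>\<in>av_ders r n. q ^ inc_suffix \<sigma>)"

lemma nth_perm_gf: "fps_nth (perm_gf r q) n = (\<Sum>\<sigma>\<in>av_perms r n. q ^ inc_suffix \<sigma>)"
  by (simp add: perm_gf_def)

lemma nth_der_gf: "fps_nth (der_gf r q) n = (\<Sum>\<sigma>\<in>av_ders r n. q ^ inc_suffix \<sigma>)"
  by (simp add: der_gf_def)

text \<open>Both trees grow by the same rule; the induction varies \<open>g\<close> because a growth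
  step replaces it by partial sums.\<close>

lemma sum_av_perms_gt_eq_lt:
  "(\<Sum>\<sigma>\<in>av_perms (>) n. g (inc_suffix \<sigma>)) = (\<Sum>\<sigma>\<in>av_perms (<) n. g (inc_suffix \<sigma>) :: 'a :: comm_monoid_add)"
  by (induction n arbitrary: g) (simp_all add: av_perms_0 sum_av_perms_gt_Suc sum_av_perms_lt_Suc)

lemma perm_gf_gt_eq_lt: "perm_gf (>) q = perm_gf (<) q"
  by (simp add: perm_gf_def sum_av_perms_gt_eq_lt)

text \<open>A permutation with suffix length \<open>s\<close> has children of total weight
  \<open>q + ... + q ^ (s + 1)\<close>. Multiplying by \<open>q - 1\<close> closes this geometric
  sum to \<open>q * (q * q ^ s - 1)\<close>; the subtracted 1 yields the series with weight
  1.\<close>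

lemma perm_gf_eq:
  "(fps_const q - 1) * (perm_gf (<) q - 1) = fps_X * (fps_const q * (fps_const q * perm_gf (<) q - perm_gf (<) 1))"
proof (rule fps_ext)
  fix n
  have geom: "(q - 1) * (\<Sum>k\<le>s. q ^ Suc k) = q * (q * q ^ s - 1)" for s
    by (induction s) (simp_all add: algebra_simps)
  have const: "fps_const q - 1 = fps_const (q - 1)"
    by (simp flip: fps_const_sub)
  show "fps_nth ((fps_const q - 1) * (perm_gf (<) q - 1)) n =
     fps_nth (fps_X * (fps_const q * (fps_const q * perm_gf (<) q - perm_gf (<) 1))) n"
  proof (cases n)
    case 0
    then show ?thesis by (simp add: perm_gf_def av_perms_0)
  next
    case (Suc m)
    have "fps_nth ((fps_const q - 1) * (perm_gf (<) q - 1)) n = (\<Sum>\<sigma>\<in>av_perms (<) m. q * (q * q ^ inc_suffix \<sigma> - 1))"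
      unfolding const
      by (simp add: Suc perm_gf_def sum_av_perms_lt_Suc sum_distrib_left flip: geom del: power_Suc)
    then show ?thesis
      by (simp add: Suc perm_gf_def sum_distrib_left sum_subtractf right_diff_distrib mult.commute)
  qed
qed

text \<open>The summands are: no fixed point; the largest fixed point followed by a nonempty
  derangement, which alone carries the suffix; the largest fixed point in last place, adding a
  factor \<open>q\<close> to the weight of what precedes.\<close>

lemma perm_gf_gt_fixed_point:
  "perm_gf (>) q = der_gf (>) q + fps_X * (perm_gf (>) 1 * (der_gf (>) q - 1)) + fps_X * (fps_const q * perm_gf (>) q)"
proof (rule fps_ext)
  fix n
  let ?P = "\<lambda>q n. \<Sum>\<sigma>\<in>av_perms (>) n. q ^ inc_suffix \<sigma> :: 'a"
    and ?D = "\<lambda>n. \<Sum>\<sigma>\<in>av_ders (>) n. q ^ inc_suffix \<sigma>"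
  show "fps_nth (perm_gf (>) q) n = fps_nth (der_gf (>) q + fps_X * (perm_gf (>) 1 * (der_gf (>) q - 1)) +
      fps_X * (fps_const q * perm_gf (>) q)) n"
  proof (cases n)
    case 0
    then show ?thesis by (simp add: perm_gf_def der_gf_def av_perms_0 av_ders_0)
  next
    case (Suc m)
    have "?P q n = ?D n + (\<Sum>k<Suc m. \<Sum>\<alpha>\<in>av_perms (>) k. \<Sum>\<beta>\<in>av_ders (>) (m - k).
        q ^ (if m - k = 0 then Suc (inc_suffix \<alpha>) else inc_suffix \<beta>))"
      unfolding Suc by (simp only: sum_av_perms_gt_fixed_point[of "\<lambda>s. q ^ s" "Suc m"] diff_Suc_Suc)
    also have "(\<Sum>k<Suc m. \<Sum>\<alpha>\<in>av_perms (>) k. \<Sum>\<beta>\<in>av_ders (>) (m - k).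
        q ^ (if m - k = 0 then Suc (inc_suffix \<alpha>) else inc_suffix \<beta>)) =
        (\<Sum>k<m. ?P 1 k * ?D (m - k)) + q * ?P q m"
      by (simp add: sum_distrib_left av_ders_0)
    \<comment> \<open>Subtracting the empty derangement makes the term at \<open>k = m\<close>
      vanish, so the sum becomes a full convolution.\<close>
    also have "(\<Sum>k<m. ?P 1 k * ?D (m - k)) = (\<Sum>k\<le>m. ?P 1 k * (?D (m - k) - (if m - k = 0 then 1 else 0)))"
      by (simp add: lessThan_Suc_atMost[symmetric] av_ders_0)
    also have "\<dots> = fps_nth (perm_gf (>) 1 * (der_gf (>) q - 1)) m"
      by (simp add: fps_mult_nth nth_perm_gf nth_der_gf atLeast0AtMost)
    finally show ?thesis
      by (simp add: Suc nth_perm_gf nth_der_gf add.assoc)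
  qed
qed

lemma sorted_av_perms_iff: "\<tau> \<in> av_perms (<) m \<Longrightarrow> sorted \<tau> \<longleftrightarrow> \<tau> = [0..<m]"
  using sorted_distinct_set_unique[of \<tau> "[0..<m]"] by (auto simp: av_perms_iff lessThan_atLeast0)

lemma upt_in_av_perms: "[0..<m] \<in> av_perms (<) m"
proof -
  have "av (<) xs" if "sorted xs" for xs :: "nat list"
    using that by (induction xs) (auto simp: sorted_wrt_filter)
  then show ?thesis by (auto simp: av_perms_iff)
qed

text \<open>The only sorted permutation of each length is the identity, so \<open>geo q\<close> is
  the share of sorted \<tau> in \<open>perm_gf (<) q\<close>. An unsorted \<tau> carries the whole
  weight and its block counts with weight 1; a sorted one adds its length and the fixed point to the
  suffix of the block.\<close>

lemma perm_gf_lt_fixed_point: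
  defines "geo \<equiv> \<lambda>q. Abs_fps (\<lambda>j. q ^ j)"
  shows "perm_gf (<) q = der_gf (<) q + fps_X * (der_gf (<) 1 * (perm_gf (<) q - geo q)) +
    fps_X * (fps_const q * (der_gf (<) q * geo q))"
proof (rule fps_ext)
  fix n
  let ?P = "\<lambda>n. \<Sum>\<sigma>\<in>av_perms (<) n. q ^ inc_suffix \<sigma> :: 'a"
    and ?D = "\<lambda>q n. \<Sum>\<sigma>\<in>av_ders (<) n. q ^ inc_suffix \<sigma>"
  have inner: "(\<Sum>\<beta>\<in>av_ders (<) k. \<Sum>\<tau>\<in>av_perms (<) j. q ^ (if sorted \<tau> then Suc (inc_suffix \<beta> + j) else inc_suffix \<tau>)) =
      ?D 1 k * (?P j - q ^ j) + q * (?D q k * q ^ j)" for k j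
  proof -
    have "(\<Sum>\<tau>\<in>av_perms (<) j. q ^ (if sorted \<tau> then Suc (s + j) else inc_suffix \<tau>)) = (?P j - q ^ j) + q * (q ^ s * q ^ j)" for s
    proof -
      have "(\<Sum>\<tau>\<in>av_perms (<) j. q ^ (if sorted \<tau> then Suc (s + j) else inc_suffix \<tau>)) =
          q ^ Suc (s + j) + (\<Sum>\<tau>\<in>av_perms (<) j - {[0..<j]}. q ^ inc_suffix \<tau>)"
        by (subst sum.remove[OF finite_av_perms upt_in_av_perms])
           (auto intro!: arg_cong2[where f = "(+)"] sum.cong simp: sorted_av_perms_iff split: if_splits)
      also have "(\<Sum>\<tau>\<in>av_perms (<) j - {[0..<j]}. q ^ inc_suffix \<tau>) = ?P j - q ^ j"
        using sum.remove[OF finite_av_perms upt_in_av_perms, of "\<lambda>\<tau>. q ^ inc_suffix \<tau>" j]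
        by (simp add: inc_suffix_sorted)
      finally show ?thesis by (simp add: power_add algebra_simps)
    qed
    then show ?thesis
      by (simp add: sum.distrib sum_distrib_left sum_distrib_right)
  qed
  show "fps_nth (perm_gf (<) q) n = fps_nth (der_gf (<) q + fps_X * (der_gf (<) 1 * (perm_gf (<) q - geo q)) +
    fps_X * (fps_const q * (der_gf (<) q * geo q))) n"
  proof (cases n)
    case 0
    then show ?thesis by (simp add: perm_gf_def der_gf_def av_perms_0 av_ders_0)
  next
    case (Suc m)
    have "?P n = ?D q n + (\<Sum>k<Suc m. \<Sum>\<beta>\<in>av_ders (<) k. \<Sum>\<tau>\<in>av_perms (<) (m - k).
        q ^ (if sorted \<tau> then Suc (inc_suffix \<beta> + (m - k)) else inc_suffix \<tau>))"
      unfolding Suc by (simp only: sum_av_perms_lt_fixed_point[of "\<lambda>s. q ^ s" "Suc m"] diff_Suc_Suc)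
    then have "?P n = ?D q n + ((\<Sum>k\<le>m. ?D 1 k * (?P (m - k) - q ^ (m - k))) + q * (\<Sum>k\<le>m. ?D q k * q ^ (m - k)))"
      unfolding inner sum.distrib by (simp only: sum_distrib_left lessThan_Suc_atMost)
    moreover have "(\<Sum>k\<le>m. ?D 1 k * (?P (m - k) - q ^ (m - k))) =
        fps_nth (der_gf (<) 1 * (perm_gf (<) q - geo q)) m"
      by (simp add: fps_mult_nth nth_perm_gf nth_der_gf geo_def atLeast0AtMost)
    moreover have "(\<Sum>k\<le>m. ?D q k * q ^ (m - k)) = fps_nth (der_gf (<) q * geo q) m"
      by (simp add: fps_mult_nth nth_der_gf geo_def atLeast0AtMost)
    ultimately show ?thesis
      by (simp add: Suc nth_perm_gf nth_der_gf add.assoc)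
  qed
qed

section \<open>Passing from derangements to words\<close>

lemma nth_power_geometric:
  "fps_nth ((Abs_fps (\<lambda>_. 1) :: 'a :: comm_ring_1 fps) ^ Suc s) k = of_nat ((s + k) choose k)"
proof (induction s arbitrary: k)
  case (Suc s)
  have "fps_nth ((Abs_fps (\<lambda>_. 1) :: 'a fps) ^ Suc (Suc s)) k =
      (\<Sum>i\<le>k. fps_nth ((Abs_fps (\<lambda>_. 1) :: 'a fps) ^ Suc s) i)"
    by (subst power_Suc2) (simp only: fps_mult_nth fps_nth_Abs_fps mult_1_right atLeast0AtMost)
  also have "\<dots> = of_nat (\<Sum>i\<le>k. (s + i) choose i)" by (simp only: Suc.IH of_nat_sum)
  also have "(\<Sum>i\<le>k. (s + i) choose i) = (Suc s + k) choose k" by (simp only: sum_choose_lower add_Suc)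
  finally show ?case .
qed simp

text \<open>\<open>y\<close> is the series of \<open>1 / (1 - x)\<close>, and the coefficient of
  \<open>x ^ k\<close> in \<open>y ^ (s + 1)\<close> counts the avoiding shuffles with
  \<open>k\<close> letters \<open>-1\<close>. One factor is taken outside; the other
  \<open>s\<close> form the weight of the derangement.\<close>

lemma word_gf:
  fixes y :: "'a :: comm_ring_1 fps"
  defines "y \<equiv> Abs_fps (\<lambda>_. 1)"
  shows "Abs_fps (\<lambda>n. of_nat (\<Sum>m\<le>n. \<Sum>d\<in>av_ders r m. (inc_suffix d + (n - m)) choose (n - m))) =
    y * diag (der_gf r y)"
proof -
  have "y * diag (der_gf r y) = diag (fps_const y * der_gf r y)" by (simp add: diag_simps)
  also have "\<dots> = Abs_fps (\<lambda>n. of_nat (\<Sum>m\<le>n. \<Sum>d\<in>av_ders r m. (inc_suffix d + (n - m)) choose (n - m)))"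
    by (simp add: diag_def der_gf_def sum_distrib_left fps_sum_nth y_def nth_power_geometric flip: power_Suc)
  finally show ?thesis by simp
qed

text \<open>\<open>K\<close> is \<open>(1 - sqrt (1 - 4 x)) / (2 x)\<close>: the numerator has
  constant term zero, so the shift is division by \<open>x\<close>. The quadratic equation follows
  from that of the square root after multiplying by \<open>4 x\<close>.\<close>

lemma catalan_fps:
  defines "K \<equiv> fps_shift 1 (fps_const (1 / 2) * (1 - sqrt_1m4x))"
  shows "2 * fps_X * K = 1 - sqrt_1m4x" "K = 1 + fps_X * K ^ 2"
proof -
  have S2: "sqrt_1m4x ^ 2 = 1 - 4 * fps_X"
  proof -
    have "fps_radical (\<lambda>k x. root k x) (Suc 1) (1 - 4 * fps_X :: real fps) ^ Suc 1 = 1 - 4 * fps_X"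
      using power_radical[of "1 - 4 * fps_X :: real fps" "\<lambda>k x. root k x" 1]
      by (simp add: fps_numeral_nth del: power_Suc)
    then show ?thesis by (simp add: sqrt_1m4x_def numeral_2_eq_2)
  qed
  have S0: "fps_nth sqrt_1m4x 0 = 1"
    by (simp add: sqrt_1m4x_def fps_numeral_nth)
  have "fps_X * K = fps_const (1 / 2) * (1 - sqrt_1m4x)"
    by (rule fps_ext) (simp add: K_def S0)
  then have "2 * (fps_X * K) = (2 * fps_const (1 / 2)) * (1 - sqrt_1m4x)"
    by (simp add: mult.assoc)
  also have "2 * fps_const (1 / 2) = (1 :: real fps)"
    by (simp add: numeral_fps_const)
  finally show xK: "2 * fps_X * K = 1 - sqrt_1m4x" by (simp add: mult.assoc)
  have "4 * fps_X * K = 4 * fps_X * (1 + fps_X * K ^ 2)"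
  proof -
    have "4 * fps_X * (1 + fps_X * K ^ 2) = 4 * fps_X + (2 * fps_X * K) ^ 2"
      by (simp add: power2_eq_square algebra_simps)
    also have "\<dots> = 2 * (2 * fps_X * K)"
      unfolding xK using S2 by (simp add: power2_eq_square algebra_simps)
    finally show ?thesis by (simp add: algebra_simps)
  qed
  then show "K = 1 + fps_X * K ^ 2" by simp
qed

text \<open>At \<open>q = K\<close> the kernel vanishes because \<open>K - 1 = x K ^ 2\<close>: the
  unknown series with weight \<open>K\<close> cancels and only the one with weight 1 is
  left.\<close>

lemma perm_gf_catalan:
  fixes K :: "real fps"
  assumes K: "K = 1 + fps_X * K ^ 2"
  shows "diag (perm_gf (<) 1) = K"
proof -
  let ?t = "diag (perm_gf (<) K)" and ?c = "diag (perm_gf (<) 1)"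
  have K0: "K \<noteq> 0" using K by (metis add.right_neutral mult_zero_right power_zero_numeral zero_neq_one)
  have "(K - 1) * (?t - 1) = fps_X * (K * (K * ?t - ?c))"
    using arg_cong[OF perm_gf_eq[of K], of diag] by (simp add: diag_simps)
  moreover have "K - 1 = fps_X * K ^ 2" using K by (metis add_diff_cancel_left')
  ultimately have "fps_X * K * (K * (?t - 1)) = fps_X * K * (K * ?t - ?c)"
    by (simp add: power2_eq_square algebra_simps)
  then have "K * (?t - 1) = K * ?t - ?c" using K0 by simp
  then show ?thesis by (simp add: algebra_simps)
qed

lemma geometric_fps:
  defines "y \<equiv> Abs_fps (\<lambda>_. 1 :: 'a :: comm_ring_1)"
  shows "(1 - fps_X) * y = 1"
proof (rule fps_ext)
  fix n show "fps_nth ((1 - fps_X) * y) n = fps_nth 1 n"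
    by (cases n) (simp_all add: y_def left_diff_distrib)
qed

text \<open>Since \<open>y - 1 = x y\<close>, a factor \<open>x y\<close> cancels from the
  functional equation, leaving \<open>t - 1 = y t - c\<close> for the series \<open>t\<close> with
  weight \<open>y\<close>. Multiplying by \<open>1 - x\<close> removes \<open>y\<close>.\<close>

lemma perm_gf_geometric:
  fixes y :: "real fps"
  assumes c: "c = 1 + fps_X * c ^ 2" "diag (perm_gf (<) 1) = c" and y: "(1 - fps_X) * y = 1"
  shows "diag (perm_gf (<) y) = (1 - fps_X) * c ^ 2"
proof -
  let ?t = "diag (perm_gf (<) y)"
  have y1: "y - 1 = fps_X * y" using y by (simp add: algebra_simps)
  have y0: "y \<noteq> 0" using y by auto
  have "(y - 1) * (?t - 1) = fps_X * (y * (y * ?t - c))"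
    using arg_cong[OF perm_gf_eq[of y], of diag] by (simp add: diag_simps c(2))
  then have "fps_X * y * (?t - 1) = fps_X * y * (y * ?t - c)" unfolding y1 by (simp add: mult.assoc)
  then have "?t - 1 = y * ?t - c" using y0 by simp
  then have "(1 - fps_X) * (?t - 1) = ((1 - fps_X) * y) * ?t - (1 - fps_X) * c"
    by (simp only: right_diff_distrib mult.assoc)
  then have "fps_X * ?t = (1 - fps_X) * (c - 1)" unfolding y by (simp add: algebra_simps)
  also have "c - 1 = fps_X * c ^ 2" using c(1) by (metis add_diff_cancel_left')
  finally have "fps_X * ?t = fps_X * ((1 - fps_X) * c ^ 2)" by (simp add: algebra_simps)
  then show ?thesis by simp
qed

lemma diag_der_gf_gt:
  fixes y :: "real fps"
  assumes c: "c = 1 + fps_X * c ^ 2" "diag (perm_gf (<) 1) = c" and y: "(1 - fps_X) * y = 1"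
  shows "diag (der_gf (>) y) * (1 + fps_X * c) = (1 - 2 * fps_X) * c ^ 2 + fps_X * c"
proof -
  let ?t = "diag (perm_gf (<) y)" and ?f = "diag (der_gf (>) y)"
  have t: "?t = (1 - fps_X) * c ^ 2" by (rule perm_gf_geometric[OF c y])
  have "?t = ?f + fps_X * (c * (?f - 1)) + fps_X * (y * ?t)"
    using arg_cong[OF perm_gf_gt_fixed_point[of y], of diag] by (simp add: diag_simps c(2) perm_gf_gt_eq_lt)
  also have "y * ?t = ((1 - fps_X) * y) * c ^ 2" unfolding t by (simp only: ac_simps)
  finally have "(1 - fps_X) * c ^ 2 = ?f + fps_X * (c * (?f - 1)) + fps_X * c ^ 2"
    unfolding t y by simp
  then show ?thesis by (simp add: algebra_simps)
qed

text \<open>The relation at \<open>q = y\<close> also contains the derangement series with weight 1,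
  so the relation at \<open>q = 1\<close> is solved first. Multiplying the one at
  \<open>q = y\<close> by \<open>1 - x y\<close> then clears \<open>geo y\<close>.\<close>

lemma diag_der_gf_lt:
  fixes y :: "real fps"
  assumes c: "c = 1 + fps_X * c ^ 2" "diag (perm_gf (<) 1) = c" and y: "(1 - fps_X) * y = 1"
  shows "diag (der_gf (<) y) * (1 + fps_X * c) = (1 - 2 * fps_X) * c ^ 2 + fps_X * c"
proof -
  let ?t = "diag (perm_gf (<) y)" and ?f = "diag (der_gf (<) y)" and ?f1 = "diag (der_gf (<) 1)"
  define geo where "geo = (\<lambda>q :: real fps. diag (Abs_fps (\<lambda>j. q ^ j)))"
  have rel: "diag (perm_gf (<) q) = diag (der_gf (<) q) + fps_X * (?f1 * (diag (perm_gf (<) q) - geo q)) +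
      fps_X * (q * (diag (der_gf (<) q) * geo q))" for q
    using arg_cong[OF perm_gf_lt_fixed_point[of q], of diag] by (simp add: diag_simps geo_def)
  have geo: "(1 - fps_X * q) * geo q = 1" for q
  proof -
    have "(1 - fps_X * fps_const q) * Abs_fps (\<lambda>j. q ^ j) = 1"
    proof (rule fps_ext)
      fix n show "fps_nth ((1 - fps_X * fps_const q) * Abs_fps (\<lambda>j. q ^ j)) n = fps_nth 1 n"
        by (cases n) (simp_all add: left_diff_distrib mult.assoc)
    qed
    from arg_cong[OF this, of diag] show ?thesis by (simp add: diag_simps geo_def)
  qed
  have t: "?t = (1 - fps_X) * c ^ 2" by (rule perm_gf_geometric[OF c y])
  \<comment> \<open>At \<open>q = 1\<close> the two terms with \<open>geo\<close> cancel.\<close>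
  have f1: "?f1 * (1 + fps_X * c) = c"
    using rel[of 1] by (simp add: c(2) algebra_simps)
  have "(1 - fps_X * y) * ?t = (1 - fps_X * y) * (?f + fps_X * (?f1 * (?t - geo y)) + fps_X * (y * (?f * geo y)))"
    using rel[of y] by simp
  also have "\<dots> = (1 - fps_X * y) * ?f + fps_X * ?f1 * ((1 - fps_X * y) * ?t - (1 - fps_X * y) * geo y) +
      fps_X * y * ?f * ((1 - fps_X * y) * geo y)"
    by (simp add: algebra_simps)
  finally have *: "(1 - fps_X * y) * ?t = ?f + fps_X * ?f1 * ((1 - fps_X * y) * ?t - 1)"
    unfolding geo by (simp add: algebra_simps)
  have "(1 - fps_X * y) * ?t = (1 - fps_X) * c ^ 2 - fps_X * c ^ 2 * ((1 - fps_X) * y)"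
    unfolding t by (simp add: algebra_simps)
  also have "\<dots> = (1 - 2 * fps_X) * c ^ 2" unfolding y by (simp add: algebra_simps)
  finally have **: "(1 - fps_X * y) * ?t = (1 - 2 * fps_X) * c ^ 2" .
  have "?f = (1 - 2 * fps_X) * c ^ 2 - fps_X * ?f1 * ((1 - 2 * fps_X) * c ^ 2 - 1)"
    using * unfolding ** by (simp add: algebra_simps)
  \<comment> \<open>Arranged so that \<open>?f1\<close> meets the factor \<open>1 + x c\<close> and
    their product can be replaced by \<open>c\<close>.\<close>
  moreover have ***: "(a - fps_X * g * (a - 1)) * u = a * u - fps_X * (g * u) * (a - 1)" for a g u :: "real fps"
    by (simp add: algebra_simps)
  ultimately have "?f * (1 + fps_X * c) = (1 - 2 * fps_X) * c ^ 2 * (1 + fps_X * c) -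
      fps_X * (?f1 * (1 + fps_X * c)) * ((1 - 2 * fps_X) * c ^ 2 - 1)"
    by (simp only: *** )
  then show ?thesis unfolding f1 by (simp add: algebra_simps)
qed

theorem theorem1p3:
  shows "(\<forall>n\<ge>1. card (D1_av n [3,2,1]) = card (D1_av n [1,3,2]))
    \<and> Abs_fps (\<lambda>n. if n = 0 then 1 else real (card (D1_av n [3,2,1])))
        = (1 - 3 * fps_X + 3 * fps_X ^ 2 + 2 * fps_X ^ 3
             + (fps_X ^ 2 + fps_X - 1) * sqrt_1m4x)
          / (2 * fps_X ^ 2 * (1 - fps_X) * (2 + fps_X))"
proof
  define c :: "real fps" where "c = fps_shift 1 (fps_const (1 / 2) * (1 - sqrt_1m4x))"
  note c_eqs = catalan_fps[folded c_def]
  have c: "c = 1 + fps_X * c ^ 2" by (rule c_eqs(2))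
  have pc: "diag (perm_gf (<) 1) = c" by (rule perm_gf_catalan[OF c])
  define y :: "real fps" where "y = Abs_fps (\<lambda>_. 1)"
  have y: "(1 - fps_X) * y = 1" unfolding y_def by (rule geometric_fps)
  have G321: "Abs_fps (\<lambda>n. real (card (D1_av n [3,2,1]))) = y * diag (der_gf (>) y)"
    unfolding card_D1_av_321 y_def by (rule word_gf)
  have G132: "Abs_fps (\<lambda>n. real (card (D1_av n [1,3,2]))) = y * diag (der_gf (<) y)"
    unfolding card_D1_av_132 y_def by (rule word_gf)
  \<comment> \<open>Both derangement series satisfy the same equation with the factor
    \<open>1 + x c\<close>, which cancels because its constant term is 1.\<close>
  have "fps_nth (1 + fps_X * c) 0 = 1" by simp
  then have ne: "1 + fps_X * c \<noteq> 0" by (metis fps_zero_nth zero_neq_one)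
  have "diag (der_gf (>) y) * (1 + fps_X * c) = diag (der_gf (<) y) * (1 + fps_X * c)"
    by (simp only: diag_der_gf_gt[OF c pc y] diag_der_gf_lt[OF c pc y])
  with ne have "diag (der_gf (>) y) = diag (der_gf (<) y)" by simp
  with G321 G132 have "Abs_fps (\<lambda>n. real (card (D1_av n [3,2,1]))) = Abs_fps (\<lambda>n. real (card (D1_av n [1,3,2])))"
    by simp
  then show "\<forall>n\<ge>1. card (D1_av n [3,2,1]) = card (D1_av n [1,3,2])"
    by (simp add: fps_eq_iff)
  define G where "G = Abs_fps (\<lambda>n. if n = 0 then 1 else real (card (D1_av n [3,2,1])))"
  \<comment> \<open>For \<open>n = 0\<close> only the empty word is counted, so the value 1 in the
    case split agrees with the count.\<close>
  have "card (D1_av 0 [3,2,1]) = 1"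
    unfolding card_D1_av_321 by (simp add: av_ders_0)
  then have "G = Abs_fps (\<lambda>n. real (card (D1_av n [3,2,1])))"
    by (auto simp: G_def fps_eq_iff)
  then have "(1 - fps_X) * G * (1 + fps_X * c) = ((1 - fps_X) * y) * (diag (der_gf (>) y) * (1 + fps_X * c))"
    by (simp only: G321 ac_simps)
  then have G: "(1 - fps_X) * G * (1 + fps_X * c) = (1 - 2 * fps_X) * c ^ 2 + fps_X * c"
    by (simp only: y diag_der_gf_gt[OF c pc y] mult_1_left)
  let ?num = "1 - 3 * fps_X + 3 * fps_X ^ 2 + 2 * fps_X ^ 3 + (fps_X ^ 2 + fps_X - 1) * sqrt_1m4x :: real fps"
  let ?den = "2 * fps_X ^ 2 * (1 - fps_X) * (2 + fps_X) :: real fps"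
  have S: "sqrt_1m4x = 1 - 2 * fps_X * c" using c_eqs(1) by (simp add: algebra_simps)
  have xc2: "fps_X * c ^ 2 = c - 1" using c by (metis add_diff_cancel_left')
  have "G * ?den * (1 + fps_X * c) = 2 * fps_X ^ 2 * (2 + fps_X) * ((1 - fps_X) * G * (1 + fps_X * c))"
    by (simp only: ac_simps)
  also have "\<dots> = 2 * fps_X * (2 + fps_X) * ((1 - 2 * fps_X) * (fps_X * c ^ 2) + fps_X * (fps_X * c))"
    unfolding G by (simp add: algebra_simps power2_eq_square)
  \<comment> \<open>With the square root replaced by \<open>1 - 2 x c\<close>, the two sides differ
    by a multiple of the Catalan equation. Displaying the cofactor makes this an identity of
    polynomials in \<open>x\<close> and \<open>c\<close>.\<close>
  also have "\<dots> = ?num * (1 + fps_X * c) +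
      2 * fps_X * (1 - 2 * fps_X - fps_X ^ 2) * (fps_X * c ^ 2 - (c - 1))"
    unfolding S by algebra
  also have "\<dots> = ?num * (1 + fps_X * c)" unfolding xc2 by simp
  finally have "G * ?den = ?num" using ne by simp
  moreover have "?den \<noteq> 0"
  proof -
    have "fps_nth (2 + fps_X :: real fps) 0 = 2" "fps_nth (1 - fps_X :: real fps) 0 = 1" by (simp_all add: fps_numeral_nth)
    then have "2 + fps_X \<noteq> (0 :: real fps)" "1 - fps_X \<noteq> (0 :: real fps)"
      by (metis fps_zero_nth zero_neq_numeral, metis fps_zero_nth zero_neq_one)
    then show ?thesis by simp
  qed
  ultimately show "G = ?num / ?den"
    by (metis nonzero_mult_div_cancel_right)
qed

end
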